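(* Let $K\ge 2$, $\sigma^2>0$ (with $\sigma=\sqrt{\sigma^2}$), and consider any $K$-armed bandit instance with $\sigma^2$-sub-Gaussian reward noise. Then Maillard Sampling (MS) run with inputs $K$ and $\sigma^2$ satisfies, for every $T\ge 1$, $$\mathbb{E}\,\mathsf{Reg}_T\;\le\;O\!\left(\sigma\sqrt{KT\ln(T)}\right),$$ where $O(\cdot)$ hides a universal multiplicative constant.
   Context: **Bandit problem.** There are $K$ arms, $[K]=\{1,\dots,K\}$. Arm $i$ has a reward distribution $\nu_i$ on $\mathbb{R}$ with unknown mean $\mu_i\in\mathbb{R}$, and $\nu_i$ is $\sigma^2$-sub-Gaussian: if $y\sim\nu_i$ then $\mathbb{E}[\exp(\lambda(y-\mu_i))]\le\exp(\lambda^2\sigma^2/2)$ for all $\lambda\in\mathbb{R}$. At each time $t=1,2,\dots$ the learner chooses an arm $I_t\in[K]$ (possibly at random, based on past arms and rewards), then receives a reward $y_t$ drawn from $\nu_{I_t}$, independently of the past given $I_t$. The algorithm knows $\sigma^2$. **Regret.** For an integer time horizon $T\ge1$, the (pseudo-)regret is $\mathsf{Reg}_T=\sum_{t=1}^T\left(\max_{a\in[K]}\mu_a-\mu_{I_t}\right)$. **Empirical quantities.** $N_{t,a}$ is the number of times arm $a$ has been pulled up to and including time $t$; $\hat\mu_{t,a}$ is the average of the rewards obtained from arm $a$ up to and including time $t$; $\hat\Delta_{t,a}:=\max_{b}\hat\mu_{t,b}-\hat\mu_{t,a}$. **Maillard Sampling (MS).** Input: $K\ge2$, $\sigma^2>0$.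 For $t\le K$: pull arm $I_t=t$. For $t>K$: draw $I_t$ (conditionally on the past) from the distribution $p_t$ on $[K]$ with $$p_{t,a}\propto\exp\!\left(-\frac{1}{2\sigma^2}N_{t-1,a}\hat\Delta_{t-1,a}^2\right).$$
   Formalization: The printed bound fails for unbounded gaps and at T=1, because the first K pulls are forced; the proved bound adds the regret of rounds t ≤ min(K,T). Runs are taken on the space of arm-reward sequences, which realises every law of a run. *)

theory Defs
  imports "HOL-Probability.Probability"
begin

text \<open>
  Arms are the numbers \<open>1, \<dots>, K\<close> and rounds are \<open>1, 2, \<dots>\<close>. The family \<open>\<nu>\<close> gives the reward
  distributions, \<open>s2\<close> is the variance proxy. Values of \<open>\<nu>\<close> outside \<open>{1..K}\<close>, and of the arm and
  reward sequences at round \<open>0\<close>, are never used.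
\<close>

definition arm_mean :: "(nat \<Rightarrow> real measure) \<Rightarrow> nat \<Rightarrow> real" where
  "arm_mean \<nu> a = (\<integral>x. x \<partial>\<nu> a)"

text \<open>
  The moment generating function is a nonnegative (extended) integral, so that the bound includes
  its finiteness; a Bochner integral would be \<open>0\<close> when it diverges.
\<close>

definition sub_gaussian :: "real \<Rightarrow> real measure \<Rightarrow> bool" where
  "sub_gaussian s2 D \<longleftrightarrow>
     integrable D (\<lambda>x. x) \<and>
     (\<forall>l::real. (\<integral>\<^sup>+x. ennreal (exp (l * (x - (\<integral>z. z \<partial>D)))) \<partial>D) \<le> ennreal (exp (l\<^sup>2 * s2 / 2)))"

definition sub_gaussian_bandit :: "nat \<Rightarrow> real \<Rightarrow> (nat \<Rightarrow> real measure) \<Rightarrow> bool" where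
  "sub_gaussian_bandit K s2 \<nu> \<longleftrightarrow>
     (\<forall>a\<in>{1..K}. prob_space (\<nu> a) \<and> sets (\<nu> a) = sets borel \<and> sub_gaussian s2 (\<nu> a))"

definition gap :: "nat \<Rightarrow> (nat \<Rightarrow> real measure) \<Rightarrow> nat \<Rightarrow> real" where
  "gap K \<nu> a = Max (arm_mean \<nu> ` {1..K}) - arm_mean \<nu> a"

text \<open>
  The following quantities are functions of one realised sequence \<open>A\<close> of arms and \<open>Y\<close> of rewards.
\<close>

definition regret :: "nat \<Rightarrow> (nat \<Rightarrow> real measure) \<Rightarrow> (nat \<Rightarrow> nat) \<Rightarrow> nat \<Rightarrow> real" where
  "regret K \<nu> A T = (\<Sum>t=1..T. gap K \<nu> (A t))"

definition pulls :: "(nat \<Rightarrow> nat) \<Rightarrow> nat \<Rightarrow> nat \<Rightarrow> nat" where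
  "pulls A t a = card {s \<in> {1..t}. A s = a}"

definition emp_mean :: "(nat \<Rightarrow> nat) \<Rightarrow> (nat \<Rightarrow> real) \<Rightarrow> nat \<Rightarrow> nat \<Rightarrow> real" where
  "emp_mean A Y t a = (\<Sum>s | s \<in> {1..t} \<and> A s = a. Y s) / real (pulls A t a)"

definition emp_gap :: "nat \<Rightarrow> (nat \<Rightarrow> nat) \<Rightarrow> (nat \<Rightarrow> real) \<Rightarrow> nat \<Rightarrow> nat \<Rightarrow> real" where
  "emp_gap K A Y t a = Max (emp_mean A Y t ` {1..K}) - emp_mean A Y t a"

definition ms_weight ::
    "nat \<Rightarrow> real \<Rightarrow> (nat \<Rightarrow> nat) \<Rightarrow> (nat \<Rightarrow> real) \<Rightarrow> nat \<Rightarrow> nat \<Rightarrow> real" where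
  "ms_weight K s2 A Y t a =
     exp (- (1 / (2 * s2)) * real (pulls A (t - 1) a) * (emp_gap K A Y (t - 1) a)\<^sup>2)"

definition ms_prob ::
    "nat \<Rightarrow> real \<Rightarrow> (nat \<Rightarrow> nat) \<Rightarrow> (nat \<Rightarrow> real) \<Rightarrow> nat \<Rightarrow> nat \<Rightarrow> real" where
  "ms_prob K s2 A Y t a = ms_weight K s2 A Y t a / (\<Sum>b=1..K. ms_weight K s2 A Y t b)"

text \<open>
  \<open>history_algebra\<close> is the sigma-algebra generated by \<open>I\<^sub>1, y\<^sub>1, \<dots>, I\<^sub>t, y\<^sub>t\<close>, and
  \<open>decision_algebra\<close> the one generated by \<open>I\<^sub>1, y\<^sub>1, \<dots>, I\<^sub>t\<^sub>-\<^sub>1, y\<^sub>t\<^sub>-\<^sub>1\<close> together with \<open>I\<^sub>t\<close>.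
\<close>

abbreviation history_space :: "nat \<Rightarrow> nat \<Rightarrow> (nat \<Rightarrow> nat \<times> real) measure" where
  "history_space K t \<equiv> PiM {1..t} (\<lambda>_. count_space {1..K} \<Otimes>\<^sub>M borel)"

definition history_algebra ::
    "'w measure \<Rightarrow> nat \<Rightarrow> (nat \<Rightarrow> 'w \<Rightarrow> nat) \<Rightarrow> (nat \<Rightarrow> 'w \<Rightarrow> real) \<Rightarrow> nat \<Rightarrow> 'w measure" where
  "history_algebra M K I y t =
     vimage_algebra (space M) (\<lambda>w. \<lambda>s\<in>{1..t}. (I s w, y s w)) (history_space K t)"

definition decision_algebra ::
    "'w measure \<Rightarrow> nat \<Rightarrow> (nat \<Rightarrow> 'w \<Rightarrow> nat) \<Rightarrow> (nat \<Rightarrow> 'w \<Rightarrow> real) \<Rightarrow> nat \<Rightarrow> 'w measure" where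
  "decision_algebra M K I y t =
     vimage_algebra (space M) (\<lambda>w. (\<lambda>s\<in>{1..t - 1}. (I s w, y s w), I t w))
       (history_space K (t - 1) \<Otimes>\<^sub>M count_space {1..K})"

text \<open>
  The assumption \<open>reward_law\<close> says that \<open>\<nu> (I t)\<close> is the conditional law of \<open>y t\<close> given the past
  and \<open>I t\<close>, which expresses both that the reward has law \<open>\<nu> (I t)\<close> and that it is independent of
  the past given \<open>I t\<close>.
\<close>

locale bandit_interaction = prob_space M
  for M :: "'w measure" +
  fixes K :: nat and \<nu> :: "nat \<Rightarrow> real measure"
    and I :: "nat \<Rightarrow> 'w \<Rightarrow> nat" and y :: "nat \<Rightarrow> 'w \<Rightarrow> real"
  assumes arm_measurable: "t \<ge> 1 \<Longrightarrow> I t \<in> measurable M (count_space {1..K})"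
    and reward_measurable: "t \<ge> 1 \<Longrightarrow> y t \<in> borel_measurable M"
    and reward_law: "t \<ge> 1 \<Longrightarrow> B \<in> sets borel \<Longrightarrow>
      AE w in M. real_cond_exp M (decision_algebra M K I y t)
        (indicator {w \<in> space M. y t w \<in> B}) w = measure (\<nu> (I t w)) B"

locale maillard_sampling = bandit_interaction M K \<nu> I y
  for M :: "'w measure" and K :: nat and s2 :: real and \<nu> :: "nat \<Rightarrow> real measure"
    and I :: "nat \<Rightarrow> 'w \<Rightarrow> nat" and y :: "nat \<Rightarrow> 'w \<Rightarrow> real" +
  assumes initial_pulls: "t \<in> {1..K} \<Longrightarrow> AE w in M. I t w = t"
    and arm_law: "t > K \<Longrightarrow> a \<in> {1..K} \<Longrightarrow>
      AE w in M. real_cond_exp M (history_algebra M K I y (t - 1))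
        (indicator {w \<in> space M. I t w = a}) w = ms_prob K s2 (\<lambda>s. I s w) (\<lambda>s. y s w) t a"

text \<open>
  The law of a run does not depend on the sample space. To let a constant be independent of it,
  and hence of a type variable, runs can be put on the type of infinite trajectories, on which
  every joint law of \<open>(I\<^sub>t, y\<^sub>t)\<^sub>t\<close> is realised by the coordinate maps.
\<close>

type_synonym trajectory = "nat \<Rightarrow> nat \<times> real"

end

theory Submission
  imports Defs
begin

text \<open>
  Fix a suboptimal arm \<open>a\<close> with gap \<open>\<Delta>\<close> and an optimal arm \<open>b\<close>. A pull of \<open>a\<close> after the initial
  rounds is of one of four kinds: \<open>a\<close> has been pulled at most \<open>16 \<sigma>\<^sup>2 ln T / \<Delta>\<^sup>2\<close> times; or \<open>a\<close> is
  overestimated by \<open>\<Delta>/4\<close>, which has geometrically decaying probability in its counter; or the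
  empirical gap of \<open>a\<close> is at least \<open>\<Delta>/2\<close>, so that the sampling probability is at most
  \<open>1/T\<close> up to a factor \<open>exp (- \<Delta>\<^sup>2 / (16 \<sigma>\<^sup>2))\<close>; or all empirical means, in particular that of
  \<open>b\<close>, are below the optimal mean minus \<open>\<Delta>/4\<close>. In the last case the probability of \<open>a\<close> is at most that of
  \<open>b\<close> divided by the weight of \<open>b\<close>, whose exponential growth in the deviation of \<open>b\<close> is beaten by the
  sub-Gaussian tail; the \<open>n\<close>-th pull of \<open>b\<close> then contributes \<open>O(\<sigma>\<^sup>2 / (n \<Delta>\<^sup>2))\<close>. Altogether \<open>a\<close> is
  pulled \<open>O(\<sigma>\<^sup>2 ln T / \<Delta>\<^sup>2)\<close> times, and balancing against gaps below \<open>\<sigma> sqrt (K ln T / T)\<close>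
  gives the bound.
\<close>

subsection \<open>Counters and empirical means\<close>

text \<open>The sum over the first \<open>n\<close> pulls of arm \<open>a\<close> up to round
  \<open>t\<close>: \<open>pulls A s a\<close> counts round \<open>s\<close> itself, so it equals k
  at the k-th pull. Stopping after \<open>n\<close> pulls replaces the random counter by a fixed
  index, at which tail bounds apply.\<close>

definition first_sum :: "(nat \<Rightarrow> real) \<Rightarrow> (nat \<Rightarrow> nat) \<Rightarrow> nat \<Rightarrow> nat \<Rightarrow> nat \<Rightarrow> real" where
  "first_sum f A n a t = (\<Sum>s | s \<in> {1..t} \<and> A s = a \<and> pulls A s a \<le> n. f s)"

lemma pulls_0 [simp]: "pulls A 0 a = 0"
  by (simp add: pulls_def)

lemma pulls_Suc: "pulls A (Suc t) a = pulls A t a + (if A (Suc t) = a then 1 else 0)"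
proof -
  have "{s \<in> {1..Suc t}. A s = a} =
      (if A (Suc t) = a then insert (Suc t) {s \<in> {1..t}. A s = a} else {s \<in> {1..t}. A s = a})"
    by (auto simp: le_Suc_eq)
  then show ?thesis
    by (simp add: pulls_def)
qed

lemma pulls_mono: "s \<le> t \<Longrightarrow> pulls A s a \<le> pulls A t a"
  by (auto simp: pulls_def intro!: card_mono)

lemma pulls_le: "pulls A t a \<le> t"
  by (induction t) (auto simp: pulls_Suc)

lemma pulls_pos: "s \<in> {1..t} \<Longrightarrow> A s = a \<Longrightarrow> 1 \<le> pulls A t a"
  by (simp add: pulls_def Suc_le_eq card_gt_0_iff) auto

lemma first_sum_0 [simp]: "first_sum f A n a 0 = 0"
  by (simp add: first_sum_def)

lemma first_sum_Suc:
  "first_sum f A n a (Suc t) =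
     first_sum f A n a t + (if A (Suc t) = a \<and> pulls A t a < n then f (Suc t) else 0)"
proof -
  have "{s. s \<in> {1..Suc t} \<and> A s = a \<and> pulls A s a \<le> n} =
      (if A (Suc t) = a \<and> pulls A t a < n
       then insert (Suc t) {s. s \<in> {1..t} \<and> A s = a \<and> pulls A s a \<le> n}
       else {s. s \<in> {1..t} \<and> A s = a \<and> pulls A s a \<le> n})"
    by (auto simp: le_Suc_eq pulls_Suc)
  then show ?thesis
    by (simp add: first_sum_def)
qed

lemma first_sum_all:
  assumes "pulls A t a \<le> n"
  shows "first_sum f A n a t = (\<Sum>s | s \<in> {1..t} \<and> A s = a. f s)"
proof -
  have "pulls A s a \<le> n" if "s \<in> {1..t}" for s
    using assms pulls_mono[of s t A a] that by auto
  then show ?thesis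
    unfolding first_sum_def by (intro sum.cong) auto
qed

text \<open>Once the counter has reached \<open>n\<close>, each further pull of \<open>a\<close> has
  a counter above \<open>n\<close> and adds nothing.\<close>

lemma first_sum_stable:
  assumes "t \<le> T" "n \<le> pulls A t a"
  shows "first_sum f A n a T = first_sum f A n a t"
  using assms(1)
proof (induction T rule: dec_induct)
  case (step T)
  then have "n \<le> pulls A T a"
    using assms(2) pulls_mono[of t T A a] by simp
  then show ?case
    using step by (simp add: first_sum_Suc)
qed simp

text \<open>There are \<open>min n (pulls A t a)\<close> summands. This rewrites the exponent of the
  stopped supermartingale as a Chernoff exponent.\<close>

lemma first_sum_affine:
  "first_sum (\<lambda>s. l * (f s - m) - c) A n a t =
     l * (first_sum f A n a t - m * real (min n (pulls A t a))) - c * real (min n (pulls A t a))"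
proof (induction t)
  case (Suc t)
  then show ?case
    by (cases "pulls A t a < n") (simp_all add: first_sum_Suc pulls_Suc Suc_le_eq algebra_simps)
qed simp

text \<open>
  Each value of the counter of arm \<open>a\<close> is seen by at most one pull of \<open>a\<close>, so a sum over rounds
  in which \<open>a\<close> is pulled becomes a sum over the values of its counter.
\<close>

lemma sum_over_pulls_le:
  fixes G :: "nat \<Rightarrow> real \<Rightarrow> ennreal"
  assumes "\<And>t. t \<in> {m<..T} \<Longrightarrow> 1 \<le> pulls A (t - 1) a"
  shows "(\<Sum>t\<in>{m<..T}. if A t = a then G (pulls A (t - 1) a) (emp_mean A Y (t - 1) a) else 0)
       \<le> (\<Sum>n=1..T. if n \<le> pulls A T a then G n (first_sum Y A n a T / real n) else 0)"
proof -
  define P where "P = {t \<in> {m<..T}. A t = a}"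
  define N where "N t = pulls A (t - 1) a" for t
  define H where "H n = (if n \<le> pulls A T a then G n (first_sum Y A n a T / real n) else 0)" for n
  have step: "pulls A t a = Suc (N t)" if "t \<in> P" for t
    using that pulls_Suc[of A "t - 1" a] by (auto simp: P_def N_def)
  have less: "N t < N t'" if "t \<in> P" "t' \<in> P" "t < t'" for t t'
  proof -
    have "t \<le> t' - 1"
      using that by simp
    from pulls_mono[OF this, of A a] show ?thesis
      using that step[of t] by (simp add: N_def Suc_le_eq)
  qed
  have inj: "inj_on N P"
    by (rule inj_onI) (metis less less_irrefl linorder_neqE_nat)
  have "(\<Sum>t\<in>{m<..T}. if A t = a then G (pulls A (t - 1) a) (emp_mean A Y (t - 1) a) else 0)
      = (\<Sum>t\<in>P. G (N t) (emp_mean A Y (t - 1) a))"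
    unfolding P_def N_def by (simp add: sum.If_cases Int_def)
  also have "\<dots> = (\<Sum>t\<in>P. H (N t))"
  proof (rule sum.cong[OF refl])
    fix t assume t: "t \<in> P"
    then have "t - 1 \<le> T" by (auto simp: P_def)
    moreover from this have "N t \<le> pulls A T a"
      unfolding N_def by (rule pulls_mono)
    \<comment> \<open>With index \<open>N t\<close> the truncated sum at \<open>T\<close> is the
      full sum at \<open>t - 1\<close>, so division by the index yields the empirical mean entering
      round \<open>t\<close>.\<close>
    ultimately show "G (N t) (emp_mean A Y (t - 1) a) = H (N t)"
      using first_sum_stable[of "t - 1" T "N t" A a Y] first_sum_all[of A "t - 1" a "N t" Y]
      by (simp add: H_def N_def emp_mean_def)
  qed
  also have "\<dots> = sum H (N ` P)"
    by (simp add: sum.reindex[OF inj])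
  also have "\<dots> \<le> sum H {1..T}"
  proof (rule sum_mono2)
    show "N ` P \<subseteq> {1..T}"
    proof
      fix n assume "n \<in> N ` P"
      then obtain t where t: "t \<in> P" "n = N t" by auto
      \<comment> \<open>The hypothesis excludes the counter value 0; a counter never exceeds the
        number of rounds.\<close>
      then show "n \<in> {1..T}"
        using assms[of t] pulls_le[of A "t - 1" a] by (auto simp: P_def N_def)
    qed
  qed auto
  finally show ?thesis
    by (simp add: H_def)
qed

section \<open>Measurability of counters, empirical means and weights\<close>

lemma measurable_pulls:
  assumes "\<And>s. s \<in> {1..t} \<Longrightarrow> A s \<in> measurable N (count_space UNIV)"
  shows "(\<lambda>w. pulls (\<lambda>s. A s w) t a) \<in> measurable N (count_space UNIV)"
  using assms
proof (induction t)
  case (Suc t)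
  have [measurable]: "(\<lambda>w. pulls (\<lambda>s. A s w) t a) \<in> measurable N (count_space UNIV)"
    using Suc by simp
  have [measurable]: "A (Suc t) \<in> measurable N (count_space UNIV)"
    using Suc.prems by simp
  show ?case
    unfolding pulls_Suc by measurable
qed simp

lemma borel_measurable_first_sum:
  assumes "\<And>s. s \<in> {1..t} \<Longrightarrow> A s \<in> measurable N (count_space UNIV)"
    and "\<And>s. s \<in> {1..t} \<Longrightarrow> Y s \<in> borel_measurable N"
  shows "(\<lambda>w. first_sum (\<lambda>s. Y s w) (\<lambda>s. A s w) n a t) \<in> borel_measurable N"
  using assms
proof (induction t)
  case (Suc t)
  have [measurable]: "(\<lambda>w. first_sum (\<lambda>s. Y s w) (\<lambda>s. A s w) n a t) \<in> borel_measurable N"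
    using Suc by simp
  have [measurable]: "A (Suc t) \<in> measurable N (count_space UNIV)" "Y (Suc t) \<in> borel_measurable N"
    using Suc.prems by simp_all
  have [measurable]: "(\<lambda>w. pulls (\<lambda>s. A s w) t a) \<in> measurable N (count_space UNIV)"
    using Suc.prems by (intro measurable_pulls) simp
  show ?case
    unfolding first_sum_Suc by measurable
qed simp

text \<open>Truncation at \<open>t\<close> cuts off nothing, since a counter is at most the round
  number; so the measurability of \<open>first_sum\<close> carries over.\<close>

lemma emp_mean_eq: "emp_mean A Y t a = first_sum Y A t a t / real (pulls A t a)"
  by (simp add: emp_mean_def first_sum_all pulls_le)

context
  fixes A :: "nat \<Rightarrow> 'w \<Rightarrow> nat" and Y :: "nat \<Rightarrow> 'w \<Rightarrow> real" and N :: "'w measure" and t :: nat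
  assumes A: "\<And>s. s \<in> {1..t} \<Longrightarrow> A s \<in> measurable N (count_space UNIV)"
    and Y: "\<And>s. s \<in> {1..t} \<Longrightarrow> Y s \<in> borel_measurable N"
begin

lemma borel_measurable_emp_mean:
  "(\<lambda>w. emp_mean (\<lambda>s. A s w) (\<lambda>s. Y s w) t a) \<in> borel_measurable N"
proof -
  note [measurable] = measurable_pulls[of t A N a, OF A] borel_measurable_first_sum[of t A N Y t a, OF A Y]
  show ?thesis
    unfolding emp_mean_eq by measurable
qed

lemma borel_measurable_Max_emp_mean:
  "(\<lambda>w. Max (emp_mean (\<lambda>s. A s w) (\<lambda>s. Y s w) t ` {1..K})) \<in> borel_measurable N"
proof (rule borel_measurable_Max)
qed (use borel_measurable_emp_mean in auto)

lemma borel_measurable_ms_weight: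
  "(\<lambda>w. ms_weight K s2 (\<lambda>s. A s w) (\<lambda>s. Y s w) (Suc t) a) \<in> borel_measurable N"
proof -
  note [measurable] = measurable_pulls[of t A N a, OF A] borel_measurable_emp_mean
    borel_measurable_Max_emp_mean
  show ?thesis
    unfolding ms_weight_def emp_gap_def diff_Suc_1 by measurable
qed

end

section \<open>Bounds on the sampling probabilities\<close>

lemma ms_prob_nonneg: "0 \<le> ms_prob K s2 A Y t a"
  by (auto simp: ms_prob_def ms_weight_def intro!: divide_nonneg_nonneg sum_nonneg)

text \<open>The empirically best arm has weight 1.\<close>

lemma ms_weight_sum_ge_1:
  assumes "K \<ge> 1"
  shows "1 \<le> (\<Sum>b=1..K. ms_weight K s2 A Y t b)"
proof -
  have "Max (emp_mean A Y (t - 1) ` {1..K}) \<in> emp_mean A Y (t - 1) ` {1..K}"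
    using assms by (intro Max_in) auto
  then obtain b where b: "b \<in> {1..K}" "emp_gap K A Y (t - 1) b = 0"
    by (auto simp: emp_gap_def)
  then have "1 = ms_weight K s2 A Y t b"
    by (simp add: ms_weight_def)
  also have "\<dots> \<le> (\<Sum>b=1..K. ms_weight K s2 A Y t b)"
    using b by (intro member_le_sum) (auto simp: ms_weight_def)
  finally show ?thesis .
qed

text \<open>The normalising sum is at least 1.\<close>

lemma ms_prob_le_weight: "K \<ge> 1 \<Longrightarrow> ms_prob K s2 A Y t a \<le> ms_weight K s2 A Y t a"
  using ms_weight_sum_ge_1[of K s2 A Y t]
  by (simp add: ms_prob_def divide_le_eq ms_weight_def mult_left_le)

text \<open>The weight of \<open>a\<close> is at most 1, so its probability is at most the
  reciprocal of the normalising sum, which is the right-hand side.\<close>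

lemma ms_prob_le_ratio:
  assumes "K \<ge> 1" "s2 > 0"
  shows "ms_prob K s2 A Y t a \<le> ms_prob K s2 A Y t b / ms_weight K s2 A Y t b"
proof -
  have "ms_weight K s2 A Y t a \<le> 1"
    using assms by (simp add: ms_weight_def)
  moreover have "0 < (\<Sum>b=1..K. ms_weight K s2 A Y t b)"
    using ms_weight_sum_ge_1[of K s2 A Y t] assms by linarith
  moreover have "ms_weight K s2 A Y t b \<noteq> 0"
    by (simp add: ms_weight_def)
  ultimately show ?thesis
    by (simp add: ms_prob_def divide_right_mono)
qed

subsection \<open>Concentration under adaptive sampling\<close>

text \<open>Turns the almost sure conditional probabilities of the model into identities between
  nonnegative integrals, where the test function \<open>f\<close> may be unbounded. An indicator has
  negative part 0, so its \<open>real_cond_exp\<close> is determined by \<open>nn_cond_exp\<close>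
  alone.\<close>

lemma (in sigma_finite_subalgebra) nn_integral_indicator_of_cond_prob:
  assumes S: "S \<in> sets M"
    and p: "AE w in M. real_cond_exp M F (indicator S) w = p w"
    and f: "f \<in> borel_measurable F"
  shows "(\<integral>\<^sup>+w. f w * indicator S w \<partial>M) = (\<integral>\<^sup>+w. f w * ennreal (p w) \<partial>M)"
proof -
  let ?g = "nn_cond_exp M F (indicator S)"
  have eq: "(\<lambda>x. ennreal (indicator S x)) = indicator S"
    by (auto simp: indicator_def)
  have "AE w in M. ?g w \<le> nn_cond_exp M F (\<lambda>_. 1) w"
    using S by (intro nn_cond_exp_mono) (auto simp: indicator_def)
  moreover have "AE w in M. 1 = nn_cond_exp M F (\<lambda>_. 1) w"
    by (intro nn_cond_exp_F_meas) simp
  moreover have "AE w in M. 0 = nn_cond_exp M F (\<lambda>x. ennreal (- indicator S x)) w"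
    using nn_cond_exp_F_meas[of "\<lambda>_. 0"] by (simp add: ennreal_neg)
  ultimately have "AE w in M. ?g w = ennreal (p w)"
    using p
  proof eventually_elim
    case (elim w)
    \<comment> \<open>\<open>enn2real\<close> maps infinity to 0; the bound by 1 rules this case
      out, so that \<open>enn2real\<close> can be inverted.\<close>
    have "?g w \<noteq> \<top>"
      using elim(1,2) by (metis ennreal_one_neq_top top.extremum_uniqueI)
    moreover have "p w = enn2real (?g w)"
      using elim by (simp add: real_cond_exp_def eq)
    ultimately show ?case
      by (simp add: ennreal_enn2real_if)
  qed
  then have "(\<integral>\<^sup>+w. f w * ?g w \<partial>M) = (\<integral>\<^sup>+w. f w * ennreal (p w) \<partial>M)"
    by (intro nn_integral_cong_AE) auto
  then show ?thesis
    using nn_cond_exp_intg[OF f, of "indicator S"] S by simp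
qed

lemma measurable_count_space_UNIV:
  "f \<in> measurable N (count_space S) \<Longrightarrow> f \<in> measurable N (count_space UNIV)"
  by (rule measurable_compose[of f _ "count_space S" "\<lambda>x. x"]) simp_all

text \<open>A geometric series with ratio \<open>q = exp (- x)\<close> and sum
  \<open>q / (1 - q)\<close>, that is \<open>1 / (exp x - 1)\<close>; then
  \<open>1 + x \<le> exp x\<close>.\<close>

lemma suminf_exp_le:
  assumes "x > 0"
  shows "(\<Sum>k. ennreal (exp (- (real (Suc k) * x)))) \<le> ennreal (1 / x)"
proof -
  define q where "q = exp (- x)"
  have q: "0 < q" "q < 1"
    using assms by (auto simp: q_def)
  have "(\<lambda>k. q * q ^ k) sums (q * (1 / (1 - q)))"
    using q by (intro sums_mult geometric_sums) simp
  moreover have "q * q ^ k = exp (- (real (Suc k) * x))" for k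
    by (simp add: q_def exp_of_nat_mult[symmetric] exp_add[symmetric] algebra_simps)
  ultimately have *: "(\<lambda>k. exp (- (real (Suc k) * x))) sums (q * (1 / (1 - q)))"
    by simp
  have "q * (1 + x) \<le> q * exp x"
    using q by (intro mult_left_mono) auto
  then have "q * x \<le> 1 - q"
    by (simp add: q_def exp_add[symmetric] algebra_simps)
  then have "q * (1 / (1 - q)) \<le> 1 / x"
    using q assms by (simp add: field_simps)
  then show ?thesis
    using * by (subst suminf_ennreal_eq[where x = "q * (1 / (1 - q))"]) (auto intro: ennreal_leI)
qed

lemma sum_exp_le:
  assumes "x > 0"
  shows "(\<Sum>n=1..T. ennreal (exp (- (real n * x)))) \<le> ennreal (1 / x)"
proof -
  have "(\<Sum>n=1..T. ennreal (exp (- (real n * x)))) = (\<Sum>k<T. ennreal (exp (- (real (Suc k) * x))))"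
    by (simp add: sum.atLeast1_atMost_eq del: of_nat_Suc)
  also have "\<dots> \<le> (\<Sum>k. ennreal (exp (- (real (Suc k) * x))))"
    by (rule sum_le_suminf) auto
  finally show ?thesis
    using suminf_exp_le[OF assms] by simp
qed

text \<open>Each new term is at most the increment of the logarithm, by
  \<open>ln u \<le> u - 1\<close> at \<open>u = 1 - 1 / real (Suc T)\<close>.\<close>

lemma sum_inverse_le_ln:
  assumes "T \<ge> 1"
  shows "(\<Sum>n=1..T. 1 / real n) \<le> 1 + ln (real T)"
  using assms
proof (induction T rule: dec_induct)
  case (step T)
  have "1 / real (Suc T) \<le> - ln (1 - 1 / real (Suc T))"
    using step ln_le_minus_one[of "1 - 1 / real (Suc T)"] by (simp add: field_simps)
  also have "1 - 1 / real (Suc T) = real T / real (Suc T)"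
    by (simp add: field_simps)
  also have "- ln (real T / real (Suc T)) = ln (real (Suc T)) - ln (real T)"
    using step by (simp add: ln_div)
  finally show ?case
    using step by simp
qed simp

text \<open>
  Peeling: on the slice \<open>k * e / 2 \<le> z < (k + 1) * e / 2\<close> the growth of the left-hand side is
  beaten by a Chernoff bound with parameter \<open>(k * e / 2 + e) / s2\<close>, at the cost of a geometrically
  decaying factor.
\<close>

lemma exp_square_le_suminf:
  fixes e s2 z :: real and n :: nat
  assumes "e > 0" "s2 > 0" "z \<ge> 0"
  defines "l k \<equiv> (real k * (e / 2) + e) / s2"
  shows "ennreal (exp (real n * z\<^sup>2 / (2 * s2))) \<le>
    (\<Sum>k. ennreal (exp (- (real (Suc k) * (real n * e\<^sup>2 / (4 * s2))))) *
        ennreal (exp (l k * (real n * (z + e)) - real n * ((l k)\<^sup>2 * s2 / 2))))"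
proof -
  define k where "k = nat \<lfloor>z / (e / 2)\<rfloor>"
  define h where "h = e / 2"
  have h: "h > 0" "e = 2 * h"
    using assms by (auto simp: h_def)
  have "real k \<le> z / h" "z / h \<le> real k + 1"
    using assms by (auto simp: k_def h_def)
  then have k: "real k * h \<le> z" "z \<le> (real k + 1) * h"
    using h by (auto simp: field_simps)
  \<comment> \<open>The square is bounded at the upper end of the slice and the linear term at its
    lower end. Since \<open>e = 2 * h\<close>, the coefficient \<open>(real k + 2) * h\<close> is
    \<open>real k * h + e\<close>, the Chernoff parameter times \<open>s2\<close>.\<close>
  have "z\<^sup>2 - 2 * (real k + 2) * h * z \<le> ((real k + 1) * h)\<^sup>2 - 2 * (real k + 2) * h * (real k * h)"
    using k h assms(3) by (intro diff_mono power_mono mult_left_mono) auto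
  then have "z\<^sup>2 \<le> 2 * (real k * h + e) * (z + e) - (real k * h + e)\<^sup>2 - (2 * real k + 3) * h\<^sup>2"
    unfolding h(2) by (simp add: power2_eq_square algebra_simps)
  \<comment> \<open>\<open>e\<^sup>2 / 2\<close> is \<open>2 * h\<^sup>2\<close>, and
    \<open>2 * (k + 1) \<le> 2 * k + 3\<close>; what remains is the geometric decay in
    \<open>k\<close>.\<close>
  also have "\<dots> \<le> 2 * (real k * h + e) * (z + e) - (real k * h + e)\<^sup>2 - real (Suc k) * (e\<^sup>2 / 2)"
    unfolding h(2) by (simp add: power2_eq_square algebra_simps)
  finally have "real n / (2 * s2) * z\<^sup>2 \<le> real n / (2 * s2) *
      (2 * (real k * h + e) * (z + e) - (real k * h + e)\<^sup>2 - real (Suc k) * (e\<^sup>2 / 2))"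
    using assms by (intro mult_left_mono) auto
  also have "\<dots> = - (real (Suc k) * (real n * e\<^sup>2 / (4 * s2))) +
      (l k * (real n * (z + e)) - real n * ((l k)\<^sup>2 * s2 / 2))"
    using assms by (simp add: l_def h_def[symmetric] field_simps power2_eq_square)
  finally have "exp (real n * z\<^sup>2 / (2 * s2)) \<le>
      exp (- (real (Suc k) * (real n * e\<^sup>2 / (4 * s2)))) *
      exp (l k * (real n * (z + e)) - real n * ((l k)\<^sup>2 * s2 / 2))"
    unfolding exp_add[symmetric] by simp
  then have "ennreal (exp (real n * z\<^sup>2 / (2 * s2))) \<le>
      ennreal (exp (- (real (Suc k) * (real n * e\<^sup>2 / (4 * s2))))) *
      ennreal (exp (l k * (real n * (z + e)) - real n * ((l k)\<^sup>2 * s2 / 2)))"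
    by (subst ennreal_mult[symmetric]) (auto intro: ennreal_leI)
  also have "\<dots> = (\<Sum>k\<in>{k}. ennreal (exp (- (real (Suc k) * (real n * e\<^sup>2 / (4 * s2))))) *
        ennreal (exp (l k * (real n * (z + e)) - real n * ((l k)\<^sup>2 * s2 / 2))))"
    by simp
  also have "\<dots> \<le> (\<Sum>k. ennreal (exp (- (real (Suc k) * (real n * e\<^sup>2 / (4 * s2))))) *
        ennreal (exp (l k * (real n * (z + e)) - real n * ((l k)\<^sup>2 * s2 / 2))))"
    by (rule sum_le_suminf) auto
  finally show ?thesis .
qed

context bandit_interaction
begin

section \<open>The sigma-algebras of the past\<close>

lemma measurable_history_map:
  "(\<lambda>w. \<lambda>s\<in>{1..t}. (I s w, y s w)) \<in> measurable M (history_space K t)"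
  using arm_measurable reward_measurable by (intro measurable_restrict measurable_Pair) auto

lemma measurable_decision_map:
  assumes "t \<ge> 1"
  shows "(\<lambda>w. (\<lambda>s\<in>{1..t - 1}. (I s w, y s w), I t w))
     \<in> measurable M (history_space K (t - 1) \<Otimes>\<^sub>M count_space {1..K})"
  using measurable_history_map arm_measurable[OF assms] by (intro measurable_Pair)

lemma subalgebra_history: "subalgebra M (history_algebra M K I y t)"
  using measurable_history_map[of t]
  by (auto simp: subalgebra_def history_algebra_def measurable_iff_sets)

lemma subalgebra_decision: "t \<ge> 1 \<Longrightarrow> subalgebra M (decision_algebra M K I y t)"
  using measurable_decision_map[of t]
  by (auto simp: subalgebra_def decision_algebra_def measurable_iff_sets)

lemma sigma_finite_subalgebra_of_subalgebra:
  "subalgebra M F \<Longrightarrow> sigma_finite_subalgebra M F"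
  by (intro finite_measure_subalgebra_is_sigma_finite finite_measure_subalgebra.intro
      finite_measure_subalgebra_axioms.intro) unfold_locales

lemma measurable_arm: "t \<ge> 1 \<Longrightarrow> I t \<in> measurable M (count_space UNIV)"
  using arm_measurable by (rule measurable_count_space_UNIV)

lemma measurable_step_history:
  assumes "s \<in> {1..t}"
  shows "(\<lambda>w. (I s w, y s w)) \<in> measurable (history_algebra M K I y t) (count_space {1..K} \<Otimes>\<^sub>M borel)"
proof -
  have "(\<lambda>w. \<lambda>s\<in>{1..t}. (I s w, y s w)) \<in> measurable (history_algebra M K I y t) (history_space K t)"
    unfolding history_algebra_def
    using measurable_space[OF measurable_history_map] by (intro measurable_vimage_algebra1) auto
  from measurable_compose[OF this measurable_component_singleton[OF assms]] show ?thesis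
    using assms by simp
qed

lemma measurable_arm_history:
  "s \<in> {1..t} \<Longrightarrow> I s \<in> measurable (history_algebra M K I y t) (count_space UNIV)"
  using measurable_compose[OF measurable_step_history measurable_fst, of s t]
  by (simp add: measurable_count_space_UNIV)

lemma measurable_reward_history:
  "s \<in> {1..t} \<Longrightarrow> y s \<in> borel_measurable (history_algebra M K I y t)"
  using measurable_compose[OF measurable_step_history measurable_snd, of s t] by simp

lemma measurable_map_decision:
  assumes "t \<ge> 1"
  shows "(\<lambda>w. (\<lambda>s\<in>{1..t - 1}. (I s w, y s w), I t w))
     \<in> measurable (decision_algebra M K I y t) (history_space K (t - 1) \<Otimes>\<^sub>M count_space {1..K})"
  unfolding decision_algebra_def
  using measurable_space[OF measurable_decision_map[OF assms]] by (intro measurable_vimage_algebra1) auto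

lemma measurable_step_decision:
  assumes "s \<in> {1..t - 1}"
  shows "(\<lambda>w. (I s w, y s w)) \<in> measurable (decision_algebra M K I y t) (count_space {1..K} \<Otimes>\<^sub>M borel)"
proof -
  have "t \<ge> 1" using assms by auto
  from measurable_compose[OF measurable_compose[OF measurable_map_decision[OF this] measurable_fst]
      measurable_component_singleton[OF assms]]
  show ?thesis
    using assms by simp
qed

lemma measurable_past_arm_decision:
  "s \<in> {1..t - 1} \<Longrightarrow> I s \<in> measurable (decision_algebra M K I y t) (count_space UNIV)"
  using measurable_compose[OF measurable_step_decision measurable_fst, of s t]
  by (simp add: measurable_count_space_UNIV)

lemma measurable_reward_decision:
  "s \<in> {1..t - 1} \<Longrightarrow> y s \<in> borel_measurable (decision_algebra M K I y t)"
  using measurable_compose[OF measurable_step_decision measurable_snd, of s t] by simp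

lemma measurable_arm_decision:
  "t \<ge> 1 \<Longrightarrow> I t \<in> measurable (decision_algebra M K I y t) (count_space UNIV)"
  using measurable_compose[OF measurable_map_decision measurable_snd, of t]
  by (simp add: measurable_count_space_UNIV)

text \<open>The weight \<open>f\<close> is known before the reward and lives on the event that
  \<open>a\<close> is chosen. The image under \<open>y t\<close> of the measure with density
  \<open>f\<close> is therefore \<open>\<nu> a\<close> scaled by the mass of \<open>f\<close>, which
  is checked on Borel sets with \<open>reward_law\<close>.\<close>

lemma nn_integral_reward:
  assumes t: "t \<ge> 1" and \<nu>: "prob_space (\<nu> a)" "sets (\<nu> a) = sets borel"
    and f: "f \<in> borel_measurable (decision_algebra M K I y t)"
    and f0: "\<And>w. w \<in> space M \<Longrightarrow> I t w \<noteq> a \<Longrightarrow> f w = 0"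
    and g: "g \<in> borel_measurable borel"
  shows "(\<integral>\<^sup>+w. f w * g (y t w) \<partial>M) = (\<integral>\<^sup>+w. f w \<partial>M) * (\<integral>\<^sup>+x. g x \<partial>\<nu> a)"
proof -
  interpret F: sigma_finite_subalgebra M "decision_algebra M K I y t"
    by (intro sigma_finite_subalgebra_of_subalgebra subalgebra_decision t)
  interpret \<nu>: prob_space "\<nu> a" by (fact \<nu>)
  have [measurable]: "f \<in> borel_measurable M"
    using subalgebra_decision[OF t] f by (rule measurable_from_subalg)
  note [measurable] = reward_measurable[OF t]
  have "distr (density M f) borel (y t) = scale_measure (\<integral>\<^sup>+w. f w \<partial>M) (\<nu> a)"
  proof (rule measure_eqI)
    fix B assume "B \<in> sets (distr (density M f) borel (y t))"
    then have B [measurable]: "B \<in> sets borel" by simp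
    let ?S = "{w \<in> space M. y t w \<in> B}"
    have "emeasure (distr (density M f) borel (y t)) B = (\<integral>\<^sup>+w. f w * indicator ?S w \<partial>M)"
      by (simp add: emeasure_distr emeasure_density vimage_def Int_def conj_commute)
    also have "\<dots> = (\<integral>\<^sup>+w. f w * ennreal (measure (\<nu> (I t w)) B) \<partial>M)"
      using reward_law[OF t B] f by (intro F.nn_integral_indicator_of_cond_prob) auto
    \<comment> \<open>Where \<open>I t w\<close> differs from \<open>a\<close> the factor
      \<open>f w\<close> is 0, so \<open>\<nu> (I t w)\<close> may be replaced by
      \<open>\<nu> a\<close>.\<close>
    also have "\<dots> = (\<integral>\<^sup>+w. f w * emeasure (\<nu> a) B \<partial>M)"
      using f0 by (intro nn_integral_cong) (metis \<nu>.emeasure_eq_measure mult_zero_left)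
    also have "\<dots> = (\<integral>\<^sup>+w. f w \<partial>M) * emeasure (\<nu> a) B"
      by (rule nn_integral_multc) simp
    finally show "emeasure (distr (density M f) borel (y t)) B
        = emeasure (scale_measure (\<integral>\<^sup>+w. f w \<partial>M) (\<nu> a)) B"
      by simp
  qed (simp add: \<nu>)
  then have "(\<integral>\<^sup>+x. g x \<partial>distr (density M f) borel (y t))
      = (\<integral>\<^sup>+x. g x \<partial>scale_measure (\<integral>\<^sup>+w. f w \<partial>M) (\<nu> a))"
    by simp
  moreover have "g \<in> borel_measurable (\<nu> a)"
    using g \<nu>(2) by (simp cong: measurable_cong_sets)
  ultimately show ?thesis
    using g by (simp add: nn_integral_distr nn_integral_density nn_integral_scale_measure)
qed

text \<open>
  The exponential supermartingale of the centred rewards of arm \<open>a\<close>, stopped once \<open>a\<close> has been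
  pulled \<open>n\<close> times.
\<close>

lemma nn_integral_exp_first_sum_le_1:
  assumes \<nu>: "sub_gaussian_bandit K s2 \<nu>" and a: "a \<in> {1..K}"
  shows "(\<integral>\<^sup>+w. ennreal (exp (first_sum (\<lambda>s. l * (y s w - arm_mean \<nu> a) - l\<^sup>2 * s2 / 2)
            (\<lambda>s. I s w) n a t)) \<partial>M) \<le> 1"
proof (induction t)
  case 0
  show ?case by (simp add: emeasure_space_1)
next
  case (Suc t)
  define Z where "Z t w = first_sum (\<lambda>s. l * (y s w - arm_mean \<nu> a) - l\<^sup>2 * s2 / 2)
      (\<lambda>s. I s w) n a t" for t w
  \<comment> \<open>\<open>Q\<close> says that round \<open>Suc t\<close> is one of the first
    \<open>n\<close> pulls of \<open>a\<close>. It is decided before the reward is seen, hence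
    measurable for the decision algebra.\<close>
  define Q where "Q w \<longleftrightarrow> I (Suc t) w = a \<and> pulls (\<lambda>s. I s w) t a < n" for w
  define f where "f w = ennreal (exp (Z t w)) * indicator {w. Q w} w" for w
  define g where "g x = ennreal (exp (l * (x - arm_mean \<nu> a) - l\<^sup>2 * s2 / 2))" for x
  let ?D = "decision_algebra M K I y (Suc t)"
  have Z_D [measurable]: "Z t \<in> borel_measurable ?D"
    unfolding Z_def
    by (intro borel_measurable_first_sum borel_measurable_diff borel_measurable_times
        borel_measurable_const measurable_past_arm_decision measurable_reward_decision) auto
  have [measurable]: "I (Suc t) \<in> measurable ?D (count_space UNIV)"
    by (rule measurable_arm_decision) simp
  have [measurable]: "(\<lambda>w. pulls (\<lambda>s. I s w) t a) \<in> measurable ?D (count_space UNIV)"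
    by (intro measurable_pulls measurable_past_arm_decision) simp
  have Q_D [measurable]: "Measurable.pred ?D Q"
    unfolding Q_def by measurable
  have f_D: "f \<in> borel_measurable ?D"
    unfolding f_def by measurable
  have sub: "subalgebra M ?D"
    by (rule subalgebra_decision) simp
  note [measurable] = measurable_from_subalg[OF sub Z_D] measurable_from_subalg[OF sub Q_D]
    measurable_from_subalg[OF sub f_D] reward_measurable[of "Suc t"]
  have g [measurable]: "g \<in> borel_measurable borel"
    unfolding g_def by measurable
  have arm: "prob_space (\<nu> a)" "sets (\<nu> a) = sets borel" "sub_gaussian s2 (\<nu> a)"
    using \<nu> a by (auto simp: sub_gaussian_bandit_def)
  have [measurable]: "(\<lambda>x. ennreal (exp (l * (x - arm_mean \<nu> a)))) \<in> borel_measurable (\<nu> a)"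
    unfolding measurable_cong_sets[OF arm(2) refl] by measurable
  have "(\<integral>\<^sup>+x. g x \<partial>\<nu> a)
      = (\<integral>\<^sup>+x. ennreal (exp (l * (x - arm_mean \<nu> a))) * ennreal (exp (- (l\<^sup>2 * s2 / 2))) \<partial>\<nu> a)"
    by (simp add: g_def diff_conv_add_uminus exp_add ennreal_mult' del: add_uminus_conv_diff)
  also have "\<dots> = (\<integral>\<^sup>+x. ennreal (exp (l * (x - arm_mean \<nu> a))) \<partial>\<nu> a) * ennreal (exp (- (l\<^sup>2 * s2 / 2)))"
    by (rule nn_integral_multc) measurable
  also have "\<dots> \<le> ennreal (exp (l\<^sup>2 * s2 / 2)) * ennreal (exp (- (l\<^sup>2 * s2 / 2)))"
    using arm(3) by (intro mult_right_mono) (auto simp: sub_gaussian_def arm_mean_def)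
  also have "\<dots> = 1"
    by (simp add: ennreal_mult'[symmetric] exp_add[symmetric])
  finally have g_le: "(\<integral>\<^sup>+x. g x \<partial>\<nu> a) \<le> 1" .
  \<comment> \<open>On \<open>Q\<close> the process gains the factor \<open>g (y (Suc t) w)\<close>,
    of conditional mean at most 1; off \<open>Q\<close> it stands still.\<close>
  have "(\<integral>\<^sup>+w. ennreal (exp (Z (Suc t) w)) \<partial>M)
      = (\<integral>\<^sup>+w. f w * g (y (Suc t) w) + ennreal (exp (Z t w)) * indicator {w. \<not> Q w} w \<partial>M)"
    by (intro nn_integral_cong)
      (simp add: Z_def first_sum_Suc Q_def f_def g_def indicator_def exp_add ennreal_mult')
  also have "\<dots> = (\<integral>\<^sup>+w. f w * g (y (Suc t) w) \<partial>M)
      + (\<integral>\<^sup>+w. ennreal (exp (Z t w)) * indicator {w. \<not> Q w} w \<partial>M)"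
    by (rule nn_integral_add) measurable
  also have "(\<integral>\<^sup>+w. f w * g (y (Suc t) w) \<partial>M) = (\<integral>\<^sup>+w. f w \<partial>M) * (\<integral>\<^sup>+x. g x \<partial>\<nu> a)"
    using arm f_D g by (intro nn_integral_reward) (auto simp: f_def Q_def)
  also have "\<dots> \<le> (\<integral>\<^sup>+w. f w \<partial>M)"
    using mult_left_mono[OF g_le] by fastforce
  also have "(\<integral>\<^sup>+w. f w \<partial>M) + (\<integral>\<^sup>+w. ennreal (exp (Z t w)) * indicator {w. \<not> Q w} w \<partial>M)
      = (\<integral>\<^sup>+w. f w + ennreal (exp (Z t w)) * indicator {w. \<not> Q w} w \<partial>M)"
    by (rule nn_integral_add[symmetric]) measurable
  also have "\<dots> = (\<integral>\<^sup>+w. ennreal (exp (Z t w)) \<partial>M)"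
    by (intro nn_integral_cong) (simp add: f_def indicator_def)
  also have "\<dots> \<le> 1"
    using Suc by (simp add: Z_def)
  finally show ?case
    by (simp add: Z_def add_mono)
qed

section \<open>Tail bounds for the first rewards of an arm\<close>

lemma borel_measurable_first_sum_run:
  "(\<lambda>w. first_sum (\<lambda>s. y s w) (\<lambda>s. I s w) n a t) \<in> borel_measurable M"
  by (intro borel_measurable_first_sum measurable_arm reward_measurable) auto

lemma measurable_pulls_run:
  "(\<lambda>w. pulls (\<lambda>s. I s w) t a) \<in> measurable M (count_space UNIV)"
  by (intro measurable_pulls measurable_arm) auto

text \<open>If the \<open>n\<close>-th pull has happened by round \<open>T\<close>, the stopped
  supermartingale has exactly \<open>n\<close> factors and equals the integrand; elsewhere it is
  only nonnegative.\<close>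

lemma nn_integral_exp_first_rewards_le_1:
  assumes "sub_gaussian_bandit K s2 \<nu>" "a \<in> {1..K}"
  shows "(\<integral>\<^sup>+w. (if n \<le> pulls (\<lambda>s. I s w) T a
      then ennreal (exp (l * (first_sum (\<lambda>s. y s w) (\<lambda>s. I s w) n a T - arm_mean \<nu> a * real n)
              - real n * (l\<^sup>2 * s2 / 2))) else 0) \<partial>M) \<le> 1"
  by (rule order_trans[OF nn_integral_mono nn_integral_exp_first_sum_le_1[OF assms, of l n T]])
    (auto simp: first_sum_affine min_absorb1 mult.commute)

lemma nn_integral_upper_deviation_le:
  assumes \<nu>: "sub_gaussian_bandit K s2 \<nu>" "a \<in> {1..K}" and "s2 > 0" "d \<ge> 0" "n \<ge> 1"
  shows "(\<integral>\<^sup>+w. (if n \<le> pulls (\<lambda>s. I s w) T a then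
        (if arm_mean \<nu> a + d \<le> first_sum (\<lambda>s. y s w) (\<lambda>s. I s w) n a T / real n then 1 else 0)
      else 0) \<partial>M) \<le> ennreal (exp (- (real n * (d\<^sup>2 / (2 * s2)))))"
proof -
  note [measurable] = borel_measurable_first_sum_run measurable_pulls_run
  define S where "S w = first_sum (\<lambda>s. y s w) (\<lambda>s. I s w) n a T" for w
  \<comment> \<open>\<open>d / s2\<close> is the optimal Chernoff parameter for a deviation
    \<open>d\<close>: the linear gain is then twice the compensating term.\<close>
  define W where "W w = (if n \<le> pulls (\<lambda>s. I s w) T a
      then ennreal (exp (d / s2 * (S w - arm_mean \<nu> a * real n)
              - real n * ((d / s2)\<^sup>2 * s2 / 2))) else 0)" for w
  have [measurable]: "W \<in> borel_measurable M"
    unfolding W_def S_def by measurable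
  have W_le: "(\<integral>\<^sup>+w. W w \<partial>M) \<le> 1"
    unfolding W_def S_def by (rule nn_integral_exp_first_rewards_le_1[OF \<nu>])
  have "1 \<le> ennreal (exp (- (real n * (d\<^sup>2 / (2 * s2))))) * W w"
    if "n \<le> pulls (\<lambda>s. I s w) T a" "arm_mean \<nu> a + d \<le> S w / real n" for w
  proof -
    have "real n * d \<le> S w - arm_mean \<nu> a * real n"
      using that \<open>n \<ge> 1\<close> by (simp add: field_simps)
    then have "d / s2 * (real n * d) \<le> d / s2 * (S w - arm_mean \<nu> a * real n)"
      using assms by (intro mult_left_mono) auto
    moreover have "d / s2 * (real n * d) = real n * (d\<^sup>2 / (2 * s2)) + real n * ((d / s2)\<^sup>2 * s2 / 2)"
      using \<open>s2 > 0\<close> by (simp add: field_simps power2_eq_square)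
    ultimately show ?thesis
      using that by (simp add: W_def ennreal_mult'[symmetric] exp_add[symmetric])
  qed
  then have "(\<integral>\<^sup>+w. (if n \<le> pulls (\<lambda>s. I s w) T a then
        (if arm_mean \<nu> a + d \<le> S w / real n then 1 else 0) else 0) \<partial>M)
      \<le> (\<integral>\<^sup>+w. ennreal (exp (- (real n * (d\<^sup>2 / (2 * s2))))) * W w \<partial>M)"
    by (intro nn_integral_mono) auto
  also have "\<dots> = ennreal (exp (- (real n * (d\<^sup>2 / (2 * s2))))) * (\<integral>\<^sup>+w. W w \<partial>M)"
    by (rule nn_integral_cmult) simp
  also have "\<dots> \<le> ennreal (exp (- (real n * (d\<^sup>2 / (2 * s2))))) * 1"
    by (rule mult_left_mono[OF W_le]) simp
  finally show ?thesis
    by (simp only: S_def mult_1_right)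
qed

text \<open>The integrand is the reciprocal of a sampling weight whose empirical maximum is replaced
  by the mean minus \<open>e\<close>. The Gaussian tail alone would only just cancel its growth; the
  margin \<open>e\<close> makes the peeled series geometric with rate
  \<open>real n * e\<^sup>2 / (4 * s2)\<close>.\<close>

lemma nn_integral_lower_deviation_le:
  fixes T :: nat
  assumes \<nu>: "sub_gaussian_bandit K s2 \<nu>" "a \<in> {1..K}" and "s2 > 0" "e > 0" "n \<ge> 1"
  defines "m w \<equiv> first_sum (\<lambda>s. y s w) (\<lambda>s. I s w) n a T / real n"
  shows "(\<integral>\<^sup>+w. (if n \<le> pulls (\<lambda>s. I s w) T a then
        (if m w \<le> arm_mean \<nu> a - e
         then ennreal (exp (real n * (arm_mean \<nu> a - e - m w)\<^sup>2 / (2 * s2))) else 0)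
      else 0) \<partial>M) \<le> ennreal (4 * s2 / e\<^sup>2 * (1 / real n))"
proof -
  note [measurable] = borel_measurable_first_sum_run measurable_pulls_run
  define S where "S w = first_sum (\<lambda>s. y s w) (\<lambda>s. I s w) n a T" for w
  define l where "l k = (real k * (e / 2) + e) / s2" for k
  \<comment> \<open>The parameter is negated because the deviation is downwards.\<close>
  define W where "W k w = (if n \<le> pulls (\<lambda>s. I s w) T a
      then ennreal (exp ((- l k) * (S w - arm_mean \<nu> a * real n)
              - real n * ((- l k)\<^sup>2 * s2 / 2))) else 0)" for k w
  define c where "c k = ennreal (exp (- (real (Suc k) * (real n * e\<^sup>2 / (4 * s2)))))" for k
  have [measurable]: "W k \<in> borel_measurable M" for k
    unfolding W_def S_def by measurable
  have W_le: "(\<integral>\<^sup>+w. W k w \<partial>M) \<le> 1" for k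
    unfolding W_def S_def by (rule nn_integral_exp_first_rewards_le_1[OF \<nu>])
  have "ennreal (exp (real n * (arm_mean \<nu> a - e - m w)\<^sup>2 / (2 * s2))) \<le> (\<Sum>k. c k * W k w)"
    if "n \<le> pulls (\<lambda>s. I s w) T a" "m w \<le> arm_mean \<nu> a - e" for w
  proof -
    have "real n * ((arm_mean \<nu> a - e - m w) + e) = - (S w - arm_mean \<nu> a * real n)"
      using \<open>n \<ge> 1\<close> by (simp add: m_def S_def field_simps)
    then have W: "W k w = ennreal (exp (l k * (real n * ((arm_mean \<nu> a - e - m w) + e))
        - real n * ((l k)\<^sup>2 * s2 / 2)))" for k
      using that by (simp add: W_def del: minus_diff_eq)
    show ?thesis
      unfolding W c_def l_def by (rule exp_square_le_suminf) (use assms that in auto)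
  qed
  then have "(\<integral>\<^sup>+w. (if n \<le> pulls (\<lambda>s. I s w) T a then
        (if m w \<le> arm_mean \<nu> a - e
         then ennreal (exp (real n * (arm_mean \<nu> a - e - m w)\<^sup>2 / (2 * s2))) else 0)
      else 0) \<partial>M) \<le> (\<integral>\<^sup>+w. (\<Sum>k. c k * W k w) \<partial>M)"
    by (intro nn_integral_mono) auto
  also have "\<dots> = (\<Sum>k. \<integral>\<^sup>+w. c k * W k w \<partial>M)"
    by (rule nn_integral_suminf) measurable
  also have "\<dots> = (\<Sum>k. c k * (\<integral>\<^sup>+w. W k w \<partial>M))"
    by (intro suminf_cong nn_integral_cmult) simp
  also have "\<dots> \<le> (\<Sum>k. c k * 1)"
  proof (rule suminf_le)
    show "c k * (\<integral>\<^sup>+w. W k w \<partial>M) \<le> c k * 1" for k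
      by (rule mult_left_mono[OF W_le]) simp
  qed auto
  also have "\<dots> \<le> ennreal (1 / (real n * e\<^sup>2 / (4 * s2)))"
    unfolding mult_1_right c_def using assms(3-5) by (intro suminf_exp_le) simp
  also have "1 / (real n * e\<^sup>2 / (4 * s2)) = 4 * s2 / e\<^sup>2 * (1 / real n)"
    by simp
  finally show ?thesis .
qed

end

subsection \<open>Pulls of a suboptimal arm\<close>

context maillard_sampling
begin

section \<open>One round of sampling given the past\<close>

abbreviation cnt :: "nat \<Rightarrow> nat \<Rightarrow> 'w \<Rightarrow> nat" where
  "cnt t a w \<equiv> pulls (\<lambda>s. I s w) t a"

abbreviation avg :: "nat \<Rightarrow> nat \<Rightarrow> 'w \<Rightarrow> real" where
  "avg t a w \<equiv> emp_mean (\<lambda>s. I s w) (\<lambda>s. y s w) t a"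

abbreviation best :: "nat \<Rightarrow> 'w \<Rightarrow> real" where
  "best t w \<equiv> Max (emp_mean (\<lambda>s. I s w) (\<lambda>s. y s w) t ` {1..K})"

abbreviation weight :: "nat \<Rightarrow> nat \<Rightarrow> 'w \<Rightarrow> real" where
  "weight t a w \<equiv> ms_weight K s2 (\<lambda>s. I s w) (\<lambda>s. y s w) t a"

abbreviation arm_prob :: "nat \<Rightarrow> nat \<Rightarrow> 'w \<Rightarrow> real" where
  "arm_prob t a w \<equiv> ms_prob K s2 (\<lambda>s. I s w) (\<lambda>s. y s w) t a"

abbreviation past :: "nat \<Rightarrow> 'w measure" where
  "past t \<equiv> history_algebra M K I y (t - 1)"

lemma measurable_past:
  assumes "t > 1"
  shows "cnt (t - 1) a \<in> measurable (past t) (count_space UNIV)"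
    "avg (t - 1) a \<in> borel_measurable (past t)"
    "best (t - 1) \<in> borel_measurable (past t)"
    "weight t a \<in> borel_measurable (past t)"
proof -
  show "cnt (t - 1) a \<in> measurable (past t) (count_space UNIV)"
    by (intro measurable_pulls measurable_arm_history)
  show "avg (t - 1) a \<in> borel_measurable (past t)"
    by (intro borel_measurable_emp_mean measurable_arm_history measurable_reward_history)
  show "best (t - 1) \<in> borel_measurable (past t)"
    by (intro borel_measurable_Max_emp_mean measurable_arm_history measurable_reward_history)
  have "weight (Suc (t - 1)) a \<in> borel_measurable (past t)"
    by (intro borel_measurable_ms_weight measurable_arm_history measurable_reward_history)
  then show "weight t a \<in> borel_measurable (past t)"
    using assms by simp
qed

lemma measurable_past_M: "f \<in> borel_measurable (past t) \<Longrightarrow> f \<in> borel_measurable M"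
  by (rule measurable_from_subalg[OF subalgebra_history])

text \<open>As \<open>f\<close> is known before the arm is drawn, the event of drawing
  \<open>a\<close> may be exchanged for its conditional probability.\<close>

lemma nn_integral_arm:
  assumes t: "t > K" and a: "a \<in> {1..K}" and f: "f \<in> borel_measurable (past t)"
  shows "(\<integral>\<^sup>+w. (if I t w = a then f w else 0) \<partial>M) = (\<integral>\<^sup>+w. f w * ennreal (arm_prob t a w) \<partial>M)"
proof -
  interpret F: sigma_finite_subalgebra M "past t"
    by (intro sigma_finite_subalgebra_of_subalgebra subalgebra_history)
  have [measurable]: "I t \<in> measurable M (count_space UNIV)"
    using t a by (intro measurable_arm) auto
  have "(\<integral>\<^sup>+w. (if I t w = a then f w else 0) \<partial>M)
      = (\<integral>\<^sup>+w. f w * indicator {w \<in> space M. I t w = a} w \<partial>M)"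
    by (intro nn_integral_cong) (simp add: indicator_def)
  also have "\<dots> = (\<integral>\<^sup>+w. f w * ennreal (arm_prob t a w) \<partial>M)"
    using arm_law[OF t a] f by (intro F.nn_integral_indicator_of_cond_prob) auto
  finally show ?thesis .
qed

lemma AE_initial: "AE w in M. \<forall>t\<in>{1..K}. I t w = t"
  by (intro AE_finite_allI) (auto intro: initial_pulls)

text \<open>Round \<open>a\<close> itself is an initial pull of \<open>a\<close>, and
  \<open>a \<le> K \<le> t - 1\<close>. So no empirical mean is a division by zero after the initial
  rounds.\<close>

lemma AE_pulled:
  assumes "a \<in> {1..K}"
  shows "AE w in M. \<forall>t>K. 1 \<le> cnt (t - 1) a w"
  using AE_initial
proof eventually_elim
  case (elim w)
  show ?case
  proof (intro allI impI)
    fix t assume "t > K"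
    then have "a \<in> {1..t - 1}"
      using assms by auto
    then show "1 \<le> cnt (t - 1) a w"
      using elim assms by (intro pulls_pos[of a]) auto
  qed
qed

lemma nn_integral_sum_over_pulls_le:
  assumes a: "a \<in> {1..K}" and G: "\<And>n. G n \<in> borel_measurable borel"
  shows "(\<Sum>t\<in>{K<..T}. \<integral>\<^sup>+w. (if I t w = a then G (cnt (t - 1) a w) (avg (t - 1) a w) else 0) \<partial>M)
    \<le> (\<Sum>n=1..T. \<integral>\<^sup>+w. (if n \<le> cnt T a w
          then G n (first_sum (\<lambda>s. y s w) (\<lambda>s. I s w) n a T / real n) else 0) \<partial>M)"
proof -
  note [measurable] = borel_measurable_first_sum_run measurable_pulls_run G
  have meas: "(\<lambda>w. if I t w = a then G (cnt (t - 1) a w) (avg (t - 1) a w) else 0) \<in> borel_measurable M"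
    if "t \<in> {K<..T}" for t
  proof -
    have [measurable]: "avg (t - 1) a \<in> borel_measurable M"
      using that a by (intro measurable_past_M[of _ t] measurable_past) auto
    \<comment> \<open>The counter takes countably many values, so measurability of each
      \<open>G n\<close> suffices.\<close>
    have [measurable]: "(\<lambda>w. G (cnt (t - 1) a w) (avg (t - 1) a w)) \<in> borel_measurable M"
      by (rule measurable_compose_countable[where g = "cnt (t - 1) a"]) measurable
    have [measurable]: "I t \<in> measurable M (count_space UNIV)"
      using that by (intro measurable_arm) auto
    show ?thesis by measurable
  qed
  have "(\<Sum>t\<in>{K<..T}. \<integral>\<^sup>+w. (if I t w = a then G (cnt (t - 1) a w) (avg (t - 1) a w) else 0) \<partial>M)
    = (\<integral>\<^sup>+w. (\<Sum>t\<in>{K<..T}. if I t w = a then G (cnt (t - 1) a w) (avg (t - 1) a w) else 0) \<partial>M)"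
    by (rule nn_integral_sum[symmetric]) (rule meas)
  also have "\<dots> \<le> (\<integral>\<^sup>+w. (\<Sum>n=1..T. if n \<le> cnt T a w
          then G n (first_sum (\<lambda>s. y s w) (\<lambda>s. I s w) n a T / real n) else 0) \<partial>M)"
  proof (rule nn_integral_mono_AE)
    show "AE w in M. (\<Sum>t\<in>{K<..T}. if I t w = a then G (cnt (t - 1) a w) (avg (t - 1) a w) else 0)
      \<le> (\<Sum>n=1..T. if n \<le> cnt T a w
          then G n (first_sum (\<lambda>s. y s w) (\<lambda>s. I s w) n a T / real n) else 0)"
      using AE_pulled[OF a]
    proof eventually_elim
      case (elim w)
      show ?case
        by (rule sum_over_pulls_le[where G = G and A = "\<lambda>s. I s w" and Y = "\<lambda>s. y s w"])
          (use elim in auto)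
    qed
  qed
  also have "\<dots> = (\<Sum>n=1..T. \<integral>\<^sup>+w. (if n \<le> cnt T a w
          then G n (first_sum (\<lambda>s. y s w) (\<lambda>s. I s w) n a T / real n) else 0) \<partial>M)"
    by (rule nn_integral_sum) measurable
  finally show ?thesis .
qed

text \<open>Each counter value from 1 to \<open>x\<close> is used by at most one pull, and there are
  at most \<open>x\<close> of them.\<close>

lemma sum_few_pulls_le:
  assumes a: "a \<in> {1..K}" and "x \<ge> 0"
  shows "(\<Sum>t\<in>{K<..T}. \<integral>\<^sup>+w. (if I t w = a then (if real (cnt (t - 1) a w) \<le> x then 1 else 0) else 0) \<partial>M)
    \<le> ennreal x"
proof -
  have "(\<Sum>t\<in>{K<..T}. \<integral>\<^sup>+w. (if I t w = a then (if real (cnt (t - 1) a w) \<le> x then 1 else 0) else 0) \<partial>M)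
    \<le> (\<Sum>n=1..T. \<integral>\<^sup>+w. (if n \<le> cnt T a w then (if real n \<le> x then 1 else 0) else 0) \<partial>M)"
    by (rule nn_integral_sum_over_pulls_le[OF a, of "\<lambda>n _. if real n \<le> x then 1 else 0"]) simp
  also have "\<dots> \<le> (\<Sum>n=1..T. \<integral>\<^sup>+w. (if real n \<le> x then 1 else 0) \<partial>M)"
    by (intro sum_mono nn_integral_mono) auto
  also have "\<dots> = (\<Sum>n=1..T. if real n \<le> x then 1 else 0)"
    by (simp add: emeasure_space_1)
  also have "\<dots> = of_nat (card {n \<in> {1..T}. real n \<le> x})"
    by (simp add: sum.If_cases Int_def)
  also have "\<dots> = ennreal (real (card {n \<in> {1..T}. real n \<le> x}))"
    by (simp add: ennreal_of_nat_eq_real_of_nat)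
  also have "\<dots> \<le> ennreal x"
  proof (rule ennreal_leI)
    have "card {n \<in> {1..T}. real n \<le> x} \<le> card {1..nat \<lfloor>x\<rfloor>}"
      by (intro card_mono) (auto simp: le_nat_floor)
    also have "\<dots> = nat \<lfloor>x\<rfloor>" by simp
    finally show "real (card {n \<in> {1..T}. real n \<le> x}) \<le> x"
      using \<open>x \<ge> 0\<close> by (meson of_nat_floor of_nat_le_iff order_trans)
  qed
  finally show ?thesis .
qed

lemma sum_overestimated_le:
  assumes "sub_gaussian_bandit K s2 \<nu>" and a: "a \<in> {1..K}" and "s2 > 0" "d > 0"
  shows "(\<Sum>t\<in>{K<..T}. \<integral>\<^sup>+w. (if I t w = a
      then (if arm_mean \<nu> a + d \<le> avg (t - 1) a w then 1 else 0) else 0) \<partial>M)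
    \<le> ennreal (2 * s2 / d\<^sup>2)"
proof -
  have "(\<Sum>t\<in>{K<..T}. \<integral>\<^sup>+w. (if I t w = a
      then (if arm_mean \<nu> a + d \<le> avg (t - 1) a w then 1 else 0) else 0) \<partial>M)
    \<le> (\<Sum>n=1..T. \<integral>\<^sup>+w. (if n \<le> cnt T a w then
        (if arm_mean \<nu> a + d \<le> first_sum (\<lambda>s. y s w) (\<lambda>s. I s w) n a T / real n then 1 else 0)
        else 0) \<partial>M)"
    by (rule nn_integral_sum_over_pulls_le[OF a, of "\<lambda>_ x. if arm_mean \<nu> a + d \<le> x then 1 else 0"]) measurable
  also have "\<dots> \<le> (\<Sum>n=1..T. ennreal (exp (- (real n * (d\<^sup>2 / (2 * s2))))))"
    using assms by (intro sum_mono nn_integral_upper_deviation_le) auto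
  also have "\<dots> \<le> ennreal (1 / (d\<^sup>2 / (2 * s2)))"
    using assms by (intro sum_exp_le) auto
  finally show ?thesis by simp
qed

text \<open>
  While all empirical means are at least \<open>e\<close> below the mean of \<open>b\<close>, the probability of any arm is
  at most that of \<open>b\<close> divided by the weight of \<open>b\<close>; hence pulls of \<open>a\<close> are charged to pulls of \<open>b\<close>.
\<close>

lemma sum_underestimated_le:
  assumes "sub_gaussian_bandit K s2 \<nu>" and a: "a \<in> {1..K}" and b: "b \<in> {1..K}"
    and "s2 > 0" "e > 0" "T \<ge> 1"
  shows "(\<Sum>t\<in>{K<..T}. \<integral>\<^sup>+w. (if I t w = a
      then (if best (t - 1) w \<le> arm_mean \<nu> b - e then 1 else 0) else 0) \<partial>M)
    \<le> ennreal (4 * s2 / e\<^sup>2 * (1 + ln (real T)))"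
proof -
  \<comment> \<open>\<open>G\<close> bounds the reciprocal weight of \<open>b\<close> and depends on
    the past only through the counter and empirical mean of \<open>b\<close>, as the passage to
    counter values requires.\<close>
  define G where "G n x = (if x \<le> arm_mean \<nu> b - e
      then ennreal (exp (real n * (arm_mean \<nu> b - e - x)\<^sup>2 / (2 * s2))) else 0)" for n :: nat and x
  have G [measurable]: "G n \<in> borel_measurable borel" for n
    unfolding G_def by measurable
  have "(\<integral>\<^sup>+w. (if I t w = a then (if best (t - 1) w \<le> arm_mean \<nu> b - e then 1 else 0) else 0) \<partial>M)
      \<le> (\<integral>\<^sup>+w. (if I t w = b then G (cnt (t - 1) b w) (avg (t - 1) b w) else 0) \<partial>M)"
    if t: "t \<in> {K<..T}" for t
  proof -
    have tK: "t > K" "t > 1" using t a by auto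
    note [measurable] = measurable_past[OF tK(2)]
    let ?F = "\<lambda>w. if best (t - 1) w \<le> arm_mean \<nu> b - e then 1 else 0 :: ennreal"
    let ?H = "\<lambda>w. ?F w * ennreal (1 / weight t b w)"
    have "(\<integral>\<^sup>+w. (if I t w = a then ?F w else 0) \<partial>M) = (\<integral>\<^sup>+w. ?F w * ennreal (arm_prob t a w) \<partial>M)"
      by (rule nn_integral_arm[OF tK(1) a]) measurable
    also have "\<dots> \<le> (\<integral>\<^sup>+w. ?H w * ennreal (arm_prob t b w) \<partial>M)"
    proof (rule nn_integral_mono)
      fix w
      have "ennreal (arm_prob t a w) \<le> ennreal (1 / weight t b w * arm_prob t b w)"
        using ms_prob_le_ratio[of K s2 "\<lambda>s. I s w" "\<lambda>s. y s w" t a b] a \<open>s2 > 0\<close>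
        by (intro ennreal_leI) simp
      also have "\<dots> = ennreal (1 / weight t b w) * ennreal (arm_prob t b w)"
        by (intro ennreal_mult ms_prob_nonneg) (simp add: ms_weight_def)
      finally show "?F w * ennreal (arm_prob t a w) \<le> ?H w * ennreal (arm_prob t b w)"
        unfolding mult.assoc by (rule mult_left_mono) simp
    qed
    \<comment> \<open>The exchange of event and probability is now used backwards, for
      \<open>b\<close>.\<close>
    also have "\<dots> = (\<integral>\<^sup>+w. (if I t w = b then ?H w else 0) \<partial>M)"
      by (rule nn_integral_arm[OF tK(1) b, symmetric]) measurable
    also have "\<dots> \<le> (\<integral>\<^sup>+w. (if I t w = b then G (cnt (t - 1) b w) (avg (t - 1) b w) else 0) \<partial>M)"
    proof (rule nn_integral_mono)
      fix w
      have "?H w \<le> G (cnt (t - 1) b w) (avg (t - 1) b w)"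
      proof (cases "best (t - 1) w \<le> arm_mean \<nu> b - e")
        case True
        have avg: "avg (t - 1) b w \<le> best (t - 1) w"
          using b by (intro Max_ge) auto
        define g where "g = best (t - 1) w - avg (t - 1) b w"
        have "g\<^sup>2 \<le> (arm_mean \<nu> b - e - avg (t - 1) b w)\<^sup>2"
          using avg True by (intro power_mono) (auto simp: g_def)
        then have "real (cnt (t - 1) b w) * g\<^sup>2 / (2 * s2) \<le>
            real (cnt (t - 1) b w) * (arm_mean \<nu> b - e - avg (t - 1) b w)\<^sup>2 / (2 * s2)"
          using \<open>s2 > 0\<close> by (intro divide_right_mono mult_left_mono) auto
        moreover have "weight t b w = exp (- (1 / (2 * s2)) * real (cnt (t - 1) b w) * g\<^sup>2)"
          by (simp only: ms_weight_def emp_gap_def g_def)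
        then have "1 / weight t b w = exp (real (cnt (t - 1) b w) * g\<^sup>2 / (2 * s2))"
          by (simp add: exp_minus inverse_eq_divide)
        ultimately show ?thesis
          using True avg by (simp add: G_def)
      qed (simp add: G_def)
      then show "(if I t w = b then ?H w else 0)
          \<le> (if I t w = b then G (cnt (t - 1) b w) (avg (t - 1) b w) else 0)"
        by simp
    qed
    finally show ?thesis .
  qed
  then have "(\<Sum>t\<in>{K<..T}. \<integral>\<^sup>+w. (if I t w = a
      then (if best (t - 1) w \<le> arm_mean \<nu> b - e then 1 else 0) else 0) \<partial>M)
    \<le> (\<Sum>t\<in>{K<..T}. \<integral>\<^sup>+w. (if I t w = b then G (cnt (t - 1) b w) (avg (t - 1) b w) else 0) \<partial>M)"
    by (rule sum_mono)
  also have "\<dots> \<le> (\<Sum>n=1..T. \<integral>\<^sup>+w. (if n \<le> cnt T b w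
          then G n (first_sum (\<lambda>s. y s w) (\<lambda>s. I s w) n b T / real n) else 0) \<partial>M)"
    by (rule nn_integral_sum_over_pulls_le[OF b G])
  also have "\<dots> \<le> (\<Sum>n=1..T. ennreal (4 * s2 / e\<^sup>2 * (1 / real n)))"
    unfolding G_def using assms by (intro sum_mono nn_integral_lower_deviation_le) auto
  also have "\<dots> = ennreal (4 * s2 / e\<^sup>2 * (\<Sum>n=1..T. 1 / real n))"
    using assms by (subst sum_ennreal) (auto simp: sum_distrib_left)
  also have "\<dots> \<le> ennreal (4 * s2 / e\<^sup>2 * (1 + ln (real T)))"
    using assms sum_inverse_le_ln by (intro ennreal_leI mult_left_mono) auto
  finally show ?thesis .
qed

text \<open>The empirical gap is at least \<open>d\<close>, and the counter is large enough to make
  the weight at most \<open>1 / T\<close>. A bare \<open>1 / T\<close> would sum to a constant, too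
  much when \<open>d\<close> is large compared with \<open>sqrt s2\<close>; the additional factor in
  \<open>c\<close> repairs this.\<close>

lemma sum_well_estimated_le:
  assumes a: "a \<in> {1..K}" and "s2 > 0" "d > 0" "T \<ge> 1" and m: "m' - m \<ge> d"
  shows "(\<Sum>t\<in>{K<..T}. \<integral>\<^sup>+w. (if I t w = a
      then (if real (cnt (t - 1) a w) > 4 * s2 * ln (real T) / d\<^sup>2
              \<and> avg (t - 1) a w \<le> m \<and> m' \<le> best (t - 1) w then 1 else 0) else 0) \<partial>M)
    \<le> ennreal (4 * s2 / d\<^sup>2)"
proof -
  \<comment> \<open>Half of the exponent \<open>n * d\<^sup>2 / (2 * s2)\<close> yields
    \<open>ln (real T)\<close> by the counter threshold, the other half yields
    \<open>d\<^sup>2 / (4 * s2)\<close> by \<open>n \<ge> 1\<close>.\<close>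
  define c where "c = exp (- ln (real T) - d\<^sup>2 / (4 * s2))"
  have "(\<integral>\<^sup>+w. (if I t w = a
      then (if real (cnt (t - 1) a w) > 4 * s2 * ln (real T) / d\<^sup>2
              \<and> avg (t - 1) a w \<le> m \<and> m' \<le> best (t - 1) w then 1 else 0) else 0) \<partial>M)
      \<le> ennreal c"
    if t: "t \<in> {K<..T}" for t
  proof -
    have tK: "t > K" "t > 1" using t a by auto
    note [measurable] = measurable_past[OF tK(2)]
    let ?F = "\<lambda>w. if real (cnt (t - 1) a w) > 4 * s2 * ln (real T) / d\<^sup>2
              \<and> avg (t - 1) a w \<le> m \<and> m' \<le> best (t - 1) w then 1 else 0 :: ennreal"
    have "(\<integral>\<^sup>+w. (if I t w = a then ?F w else 0) \<partial>M) = (\<integral>\<^sup>+w. ?F w * ennreal (arm_prob t a w) \<partial>M)"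
      by (rule nn_integral_arm[OF tK(1) a]) measurable
    also have "\<dots> \<le> (\<integral>\<^sup>+w. ennreal c \<partial>M)"
      using AE_pulled[OF a]
    proof (intro nn_integral_mono_AE, eventually_elim)
      case (elim w)
      show ?case
      proof (cases "real (cnt (t - 1) a w) > 4 * s2 * ln (real T) / d\<^sup>2
              \<and> avg (t - 1) a w \<le> m \<and> m' \<le> best (t - 1) w")
        case True
        define g where "g = best (t - 1) w - avg (t - 1) a w"
        define n where "n = real (cnt (t - 1) a w)"
        have "d\<^sup>2 \<le> g\<^sup>2"
          using True m \<open>d > 0\<close> by (intro power_mono) (auto simp: g_def)
        have "n \<ge> 1"
          using elim tK by (simp add: n_def)
        then have "d\<^sup>2 \<le> n * d\<^sup>2"
          using mult_right_mono[of 1 n "d\<^sup>2"] by simp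
        moreover have "4 * s2 * ln (real T) \<le> n * d\<^sup>2"
          using True \<open>d > 0\<close> by (simp add: n_def divide_less_eq)
        moreover have "n * d\<^sup>2 \<le> n * g\<^sup>2"
          using \<open>d\<^sup>2 \<le> g\<^sup>2\<close> by (intro mult_left_mono) (auto simp: n_def)
        ultimately have "4 * s2 * ln (real T) + d\<^sup>2 \<le> 2 * (n * g\<^sup>2)"
          by linarith
        moreover have "weight t a w = exp (- (1 / (2 * s2)) * n * g\<^sup>2)"
          by (simp only: ms_weight_def emp_gap_def g_def n_def)
        ultimately have "weight t a w \<le> c"
          using \<open>s2 > 0\<close> by (simp add: c_def field_simps)
        then show ?thesis
          using True a ms_prob_le_weight[of K s2 "\<lambda>s. I s w" "\<lambda>s. y s w" t a]
          by (auto intro: ennreal_leI order_trans)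
      qed auto
    qed
    also have "\<dots> = ennreal c"
      by (simp add: emeasure_space_1)
    finally show ?thesis .
  qed
  then have "(\<Sum>t\<in>{K<..T}. \<integral>\<^sup>+w. (if I t w = a
      then (if real (cnt (t - 1) a w) > 4 * s2 * ln (real T) / d\<^sup>2
              \<and> avg (t - 1) a w \<le> m \<and> m' \<le> best (t - 1) w then 1 else 0) else 0) \<partial>M)
      \<le> (\<Sum>t\<in>{K<..T}. ennreal c)"
    by (rule sum_mono)
  also have "\<dots> = ennreal (real (T - K) * c)"
    by (simp add: ennreal_mult' ennreal_of_nat_eq_real_of_nat)
  also have "\<dots> \<le> ennreal (4 * s2 / d\<^sup>2)"
  proof (rule ennreal_leI)
    have "real (T - K) * c \<le> real T * c"
      by (intro mult_right_mono) (auto simp: c_def)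
    also have "\<dots> = exp (- (d\<^sup>2 / (4 * s2)))"
      using \<open>T \<ge> 1\<close> by (simp add: c_def exp_diff exp_minus field_simps)
    also have "\<dots> \<le> 4 * s2 / d\<^sup>2"
    proof -
      have "d\<^sup>2 / (4 * s2) \<le> exp (d\<^sup>2 / (4 * s2))"
        using exp_ge_add_one_self[of "d\<^sup>2 / (4 * s2)"] by linarith
      then have "1 / exp (d\<^sup>2 / (4 * s2)) \<le> 1 / (d\<^sup>2 / (4 * s2))"
        using assms by (intro divide_left_mono) auto
      then show ?thesis
        by (simp add: exp_minus inverse_eq_divide)
    qed
    finally show "real (T - K) * c \<le> 4 * s2 / d\<^sup>2" .
  qed
  finally show ?thesis .
qed

lemma sum_prob_pull_le:
  assumes \<nu>: "sub_gaussian_bandit K s2 \<nu>" and a: "a \<in> {1..K}" and s2: "s2 > 0"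
    and gap: "gap K \<nu> a > 0" and T: "ln (real T) \<ge> 1"
  shows "(\<Sum>t\<in>{K<..T}. prob {w \<in> space M. I t w = a}) \<le> 208 * s2 * ln (real T) / (gap K \<nu> a)\<^sup>2"
proof -
  define D where "D = gap K \<nu> a"
  have D: "D > 0" using gap by (simp add: D_def)
  have T1: "T \<ge> 1"
    using T by (cases T) auto
  have "Max (arm_mean \<nu> ` {1..K}) \<in> arm_mean \<nu> ` {1..K}"
    using a by (intro Max_in) auto
  then obtain b where b: "b \<in> {1..K}" "D = arm_mean \<nu> b - arm_mean \<nu> a"
    by (auto simp: gap_def D_def)
  \<comment> \<open>Margins of \<open>D / 4\<close> on both sides leave a separation of
    \<open>D / 2\<close>, the value of \<open>d\<close> for well estimated rounds.\<close>
  define m where "m = arm_mean \<nu> a + D / 4"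
  define m' where "m' = arm_mean \<nu> b - D / 4"
  have mm': "m' - m = D / 2"
    unfolding m_def m'_def using b(2) by linarith
  define x where "x = 4 * s2 * ln (real T) / (D / 2)\<^sup>2"
  define f1 where "f1 t w = (if I t w = a then (if real (cnt (t - 1) a w) \<le> x then 1 else 0) else 0 :: ennreal)" for t w
  define f2 where "f2 t w = (if I t w = a then (if m \<le> avg (t - 1) a w then 1 else 0) else 0 :: ennreal)" for t w
  define f3 where "f3 t w = (if I t w = a
      then (if real (cnt (t - 1) a w) > x \<and> avg (t - 1) a w \<le> m \<and> m' \<le> best (t - 1) w then 1 else 0)
      else 0 :: ennreal)" for t w
  define f4 where "f4 t w = (if I t w = a then (if best (t - 1) w \<le> m' then 1 else 0) else 0 :: ennreal)" for t w
  have "ennreal (prob {w \<in> space M. I t w = a})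
      \<le> (\<integral>\<^sup>+w. f1 t w \<partial>M) + (\<integral>\<^sup>+w. f2 t w \<partial>M) + (\<integral>\<^sup>+w. f3 t w \<partial>M) + (\<integral>\<^sup>+w. f4 t w \<partial>M)"
    if t: "t \<in> {K<..T}" for t
  proof -
    have t1: "t > 1" using t a by auto
    have sub: "subalgebra M (past t)"
      by (rule subalgebra_history)
    note [measurable] = measurable_past[OF t1, THEN measurable_from_subalg[OF sub]]
    have [measurable]: "I t \<in> measurable M (count_space UNIV)"
      using t1 by (intro measurable_arm) auto
    have [measurable]: "f1 t \<in> borel_measurable M" "f2 t \<in> borel_measurable M"
      "f3 t \<in> borel_measurable M" "f4 t \<in> borel_measurable M"
      unfolding f1_def f2_def f3_def f4_def by measurable
    have "ennreal (prob {w \<in> space M. I t w = a}) = (\<integral>\<^sup>+w. indicator {w \<in> space M. I t w = a} w \<partial>M)"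
      by (simp add: emeasure_eq_measure)
    \<comment> \<open>The cases are exhaustive: if \<open>f1\<close> and \<open>f2\<close> vanish at
      a pull of \<open>a\<close>, comparing \<open>best (t - 1) w\<close> with \<open>m'\<close>
      makes \<open>f3\<close> or \<open>f4\<close> equal to 1.\<close>
    also have "\<dots> \<le> (\<integral>\<^sup>+w. f1 t w + f2 t w + f3 t w + f4 t w \<partial>M)"
      by (intro nn_integral_mono) (auto simp: indicator_def f1_def f2_def f3_def f4_def)
    also have "\<dots> = (\<integral>\<^sup>+w. f1 t w \<partial>M) + (\<integral>\<^sup>+w. f2 t w \<partial>M) + (\<integral>\<^sup>+w. f3 t w \<partial>M) + (\<integral>\<^sup>+w. f4 t w \<partial>M)"
      by (simp add: nn_integral_add)
    finally show ?thesis .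
  qed
  then have "(\<Sum>t\<in>{K<..T}. ennreal (prob {w \<in> space M. I t w = a})) \<le>
      (\<Sum>t\<in>{K<..T}. (\<integral>\<^sup>+w. f1 t w \<partial>M) + (\<integral>\<^sup>+w. f2 t w \<partial>M) + (\<integral>\<^sup>+w. f3 t w \<partial>M) + (\<integral>\<^sup>+w. f4 t w \<partial>M))"
    by (rule sum_mono)
  also have "\<dots> = (\<Sum>t\<in>{K<..T}. \<integral>\<^sup>+w. f1 t w \<partial>M) + (\<Sum>t\<in>{K<..T}. \<integral>\<^sup>+w. f2 t w \<partial>M)
      + (\<Sum>t\<in>{K<..T}. \<integral>\<^sup>+w. f3 t w \<partial>M) + (\<Sum>t\<in>{K<..T}. \<integral>\<^sup>+w. f4 t w \<partial>M)"
    by (simp add: sum.distrib)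
  also have "\<dots> \<le> ennreal x + ennreal (2 * s2 / (D / 4)\<^sup>2) + ennreal (4 * s2 / (D / 2)\<^sup>2)
      + ennreal (4 * s2 / (D / 4)\<^sup>2 * (1 + ln (real T)))"
  proof (intro add_mono)
    show "(\<Sum>t\<in>{K<..T}. \<integral>\<^sup>+w. f1 t w \<partial>M) \<le> ennreal x"
      unfolding f1_def using a s2 T by (intro sum_few_pulls_le) (auto simp: x_def)
    show "(\<Sum>t\<in>{K<..T}. \<integral>\<^sup>+w. f2 t w \<partial>M) \<le> ennreal (2 * s2 / (D / 4)\<^sup>2)"
      unfolding f2_def m_def using \<nu> a s2 D by (intro sum_overestimated_le) auto
    show "(\<Sum>t\<in>{K<..T}. \<integral>\<^sup>+w. f3 t w \<partial>M) \<le> ennreal (4 * s2 / (D / 2)\<^sup>2)"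
      unfolding f3_def x_def using a s2 D T1 mm' by (intro sum_well_estimated_le) auto
    show "(\<Sum>t\<in>{K<..T}. \<integral>\<^sup>+w. f4 t w \<partial>M) \<le> ennreal (4 * s2 / (D / 4)\<^sup>2 * (1 + ln (real T)))"
      unfolding f4_def m'_def using \<nu> a b(1) s2 D T1 by (intro sum_underestimated_le) auto
  qed
  also have "\<dots> = ennreal (x + 2 * s2 / (D / 4)\<^sup>2 + 4 * s2 / (D / 2)\<^sup>2
      + 4 * s2 / (D / 4)\<^sup>2 * (1 + ln (real T)))"
    using s2 T by (simp add: x_def ennreal_plus[symmetric] del: ennreal_plus)
  also have "\<dots> \<le> ennreal (208 * s2 * ln (real T) / D\<^sup>2)"
  proof (rule ennreal_leI)
    \<comment> \<open>In units of \<open>s2 / D\<^sup>2\<close> and with L for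
      \<open>ln (real T)\<close>, the terms are 16 L, 32, 16 and 64 (1 + L). As L \<ge> 1, the total
      is at most 192 L, so 208 suffices.\<close>
    have "x + 2 * s2 / (D / 4)\<^sup>2 + 4 * s2 / (D / 2)\<^sup>2 + 4 * s2 / (D / 4)\<^sup>2 * (1 + ln (real T))
        = s2 / D\<^sup>2 * (80 * ln (real T) + 112)"
      using D by (simp add: x_def field_simps power2_eq_square)
    also have "\<dots> \<le> s2 / D\<^sup>2 * (208 * ln (real T))"
      using s2 T by (intro mult_left_mono) auto
    finally show "x + 2 * s2 / (D / 4)\<^sup>2 + 4 * s2 / (D / 2)\<^sup>2 + 4 * s2 / (D / 4)\<^sup>2 * (1 + ln (real T))
        \<le> 208 * s2 * ln (real T) / D\<^sup>2"
      by (simp add: ac_simps)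
  qed
  finally show ?thesis
    using s2 T by (simp add: D_def sum_nonneg)
qed

section \<open>Decomposition of the expected regret\<close>

lemma gap_arm_eq:
  assumes "t \<ge> 1" "w \<in> space M"
  shows "gap K \<nu> (I t w) = (\<Sum>a=1..K. gap K \<nu> a * indicator {w \<in> space M. I t w = a} w)"
proof -
  have "I t w \<in> {1..K}"
    using measurable_space[OF arm_measurable[OF assms(1)] assms(2)] by simp
  then show ?thesis
    using assms(2) by (simp add: indicator_def of_bool_def if_distrib[of "(*) _"] cong: if_cong)
qed

lemma
  assumes "t \<ge> 1"
  shows integrable_gap: "integrable M (\<lambda>w. gap K \<nu> (I t w))"
    and expected_gap: "(\<integral>w. gap K \<nu> (I t w) \<partial>M)
      = (\<Sum>a=1..K. gap K \<nu> a * prob {w \<in> space M. I t w = a})"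
proof -
  have [measurable]: "I t \<in> measurable M (count_space UNIV)"
    using assms by (rule measurable_arm)
  note eq = gap_arm_eq[OF assms]
  have int: "integrable M (\<lambda>w. gap K \<nu> a * indicator {w \<in> space M. I t w = a} w)" for a
    by (intro integrable_mult_right integrable_real_indicator) (auto simp: emeasure_eq_measure)
  show "integrable M (\<lambda>w. gap K \<nu> (I t w))"
  proof -
    have "integrable M (\<lambda>w. \<Sum>a=1..K. gap K \<nu> a * indicator {w \<in> space M. I t w = a} w)"
      by (intro Bochner_Integration.integrable_sum int)
    moreover have "integrable M (\<lambda>w. gap K \<nu> (I t w)) \<longleftrightarrow>
        integrable M (\<lambda>w. \<Sum>a=1..K. gap K \<nu> a * indicator {w \<in> space M. I t w = a} w)"
      by (rule Bochner_Integration.integrable_cong[OF refl eq])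
    ultimately show ?thesis by (rule iffD2[rotated])
  qed
  show "(\<integral>w. gap K \<nu> (I t w) \<partial>M) = (\<Sum>a=1..K. gap K \<nu> a * prob {w \<in> space M. I t w = a})"
  proof -
    have "(\<integral>w. gap K \<nu> (I t w) \<partial>M)
        = (\<integral>w. (\<Sum>a=1..K. gap K \<nu> a * indicator {w \<in> space M. I t w = a} w) \<partial>M)"
      by (rule Bochner_Integration.integral_cong[OF refl eq])
    also have "\<dots> = (\<Sum>a=1..K. \<integral>w. gap K \<nu> a * indicator {w \<in> space M. I t w = a} w \<partial>M)"
      by (rule Bochner_Integration.integral_sum) (rule int)
    also have "\<dots> = (\<Sum>a=1..K. gap K \<nu> a * prob ({w \<in> space M. I t w = a} \<inter> space M))"
      by (simp del: Int_iff)
    also have "\<dots> = (\<Sum>a=1..K. gap K \<nu> a * prob {w \<in> space M. I t w = a})"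
      by (intro sum.cong refl arg_cong2[where f = "(*)"] arg_cong[where f = prob]) auto
    finally show ?thesis .
  qed
qed

text \<open>The initial arms are almost surely deterministic; later rounds are regrouped by arm. For
  \<open>T \<le> K\<close> the second sum is 0.\<close>

lemma expected_regret_eq:
  "(\<integral>w. regret K \<nu> (\<lambda>t. I t w) T \<partial>M) = (\<Sum>t=1..min K T. gap K \<nu> t)
     + (\<Sum>a=1..K. gap K \<nu> a * (\<Sum>t\<in>{K<..T}. prob {w \<in> space M. I t w = a}))"
proof -
  have split: "{1..T} = {1..min K T} \<union> {K<..T}" "{1..min K T} \<inter> {K<..T} = {}"
    by auto
  have initial: "(\<integral>w. gap K \<nu> (I t w) \<partial>M) = gap K \<nu> t" if "t \<in> {1..min K T}" for t
  proof -
    have "(\<integral>w. gap K \<nu> (I t w) \<partial>M) = (\<integral>w. gap K \<nu> t \<partial>M)"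
    proof (rule integral_cong_AE)
      show "(\<lambda>w. gap K \<nu> (I t w)) \<in> borel_measurable M"
        using that by (intro borel_measurable_integrable integrable_gap) auto
      show "AE w in M. gap K \<nu> (I t w) = gap K \<nu> t"
        using initial_pulls[of t] that by auto
    qed simp
    then show ?thesis
      by (simp add: prob_space)
  qed
  have "(\<integral>w. regret K \<nu> (\<lambda>t. I t w) T \<partial>M) = (\<Sum>t=1..T. \<integral>w. gap K \<nu> (I t w) \<partial>M)"
    unfolding regret_def by (intro Bochner_Integration.integral_sum integrable_gap) simp
  also have "\<dots> = (\<Sum>t=1..min K T. \<integral>w. gap K \<nu> (I t w) \<partial>M) + (\<Sum>t\<in>{K<..T}. \<integral>w. gap K \<nu> (I t w) \<partial>M)"
    unfolding split(1) using split(2) by (intro sum.union_disjoint) auto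
  also have "(\<Sum>t=1..min K T. \<integral>w. gap K \<nu> (I t w) \<partial>M) = (\<Sum>t=1..min K T. gap K \<nu> t)"
    by (rule sum.cong[OF refl initial])
  also have "(\<Sum>t\<in>{K<..T}. \<integral>w. gap K \<nu> (I t w) \<partial>M)
      = (\<Sum>t\<in>{K<..T}. \<Sum>a=1..K. gap K \<nu> a * prob {w \<in> space M. I t w = a})"
    by (intro sum.cong refl expected_gap) auto
  also have "\<dots> = (\<Sum>a=1..K. gap K \<nu> a * (\<Sum>t\<in>{K<..T}. prob {w \<in> space M. I t w = a}))"
    unfolding sum_distrib_left by (rule sum.swap)
  finally show ?thesis .
qed

lemma sum_prob_arms:
  assumes "t \<ge> 1"
  shows "(\<Sum>a=1..K. prob {w \<in> space M. I t w = a}) = 1"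
proof -
  have [measurable]: "I t \<in> measurable M (count_space UNIV)"
    using assms by (rule measurable_arm)
  have "(\<Sum>a=1..K. prob {w \<in> space M. I t w = a}) = prob (\<Union>a\<in>{1..K}. {w \<in> space M. I t w = a})"
    by (intro finite_measure_finite_Union[symmetric]) (auto simp: disjoint_family_on_def)
  also have "(\<Union>a\<in>{1..K}. {w \<in> space M. I t w = a}) = space M"
    using measurable_space[OF arm_measurable[OF assms]] by auto
  finally show ?thesis
    by (simp add: prob_space)
qed

text \<open>The initial rounds stay a separate term because gaps are unbounded: for
  \<open>T = 1\<close> the logarithm is 0 while the regret is the gap of arm 1. For the later rounds
  the gap-dependent bound is balanced against a threshold.\<close>

lemma expected_regret_le:
  assumes \<nu>: "sub_gaussian_bandit K s2 \<nu>" and s2: "s2 > 0" and K: "K \<ge> 2" and T: "T \<ge> 1"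
  shows "(\<integral>w. regret K \<nu> (\<lambda>t. I t w) T \<partial>M)
     \<le> 209 * (sqrt s2 * sqrt (real K * real T * ln (real T))) + (\<Sum>t=1..min K T. gap K \<nu> t)"
proof (cases "T \<le> K")
  case True
  then show ?thesis
    using T s2 by (simp add: expected_regret_eq)
next
  case False
  \<comment> \<open>Here \<open>T > K \<ge> 2\<close>, so \<open>T \<ge> 3\<close>, which exceeds
    \<open>exp 1\<close>.\<close>
  then have "exp 1 \<le> real T"
    using exp_le K by linarith
  then have L: "ln (real T) \<ge> 1"
    using T by (subst ln_ge_iff) auto
  define R where "R = sqrt s2 * sqrt (real K * real T * ln (real T))"
  \<comment> \<open>The threshold equals sigma times \<open>sqrt (K * ln T / T)\<close>. Arms with
    smaller gaps cost at most \<open>D0 * T = R\<close> together, and the other \<open>K\<close> or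
    fewer arms at most \<open>208 * R\<close>.\<close>
  define D0 where "D0 = R / real T"
  define P where "P a = (\<Sum>t\<in>{K<..T}. prob {w \<in> space M. I t w = a})" for a
  have R: "R > 0" "R * R = s2 * (real K * real T * ln (real T))"
  proof -
    have "s2 * (real K * real T * ln (real T)) > 0"
      using s2 K False by (intro mult_pos_pos) auto
    then show "R > 0" "R * R = s2 * (real K * real T * ln (real T))"
      unfolding R_def real_sqrt_mult[symmetric] by simp_all
  qed
  have D0: "D0 > 0" "D0 * real T = R"
    using R T by (auto simp: D0_def)
  have B: "real K * (208 * s2 * ln (real T) / D0) = 208 * R"
    using R T by (simp add: D0_def field_simps)
  have each: "gap K \<nu> a * P a \<le> D0 * P a + 208 * s2 * ln (real T) / D0" if a: "a \<in> {1..K}" for a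
  proof (cases "gap K \<nu> a \<le> D0")
    case True
    have "gap K \<nu> a * P a \<le> D0 * P a"
      using True by (intro mult_right_mono) (auto simp: P_def sum_nonneg)
    moreover have "0 \<le> 208 * s2 * ln (real T) / D0"
      using s2 L D0 by simp
    ultimately show ?thesis by linarith
  next
    case False
    then have g: "gap K \<nu> a > 0" "gap K \<nu> a \<ge> D0"
      using D0 by auto
    have "gap K \<nu> a * P a \<le> gap K \<nu> a * (208 * s2 * ln (real T) / (gap K \<nu> a)\<^sup>2)"
      unfolding P_def using sum_prob_pull_le[OF \<nu> a s2 g(1) L] g by (intro mult_left_mono) auto
    also have "\<dots> = 208 * s2 * ln (real T) / gap K \<nu> a"
      using g by (simp add: power2_eq_square)
    also have "\<dots> \<le> 208 * s2 * ln (real T) / D0"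
      using g D0 s2 L by (intro divide_left_mono) auto
    finally show ?thesis
      using D0 by (simp add: P_def sum_nonneg add_increasing)
  qed
  have "(\<Sum>a=1..K. P a) = (\<Sum>t\<in>{K<..T}. \<Sum>a=1..K. prob {w \<in> space M. I t w = a})"
    unfolding P_def by (rule sum.swap)
  also have "\<dots> = (\<Sum>t\<in>{K<..T}. 1)"
    by (intro sum.cong refl sum_prob_arms) auto
  also have "\<dots> \<le> real T"
    by simp
  finally have P: "(\<Sum>a=1..K. P a) \<le> real T" .
  have "(\<Sum>a=1..K. gap K \<nu> a * P a) \<le> (\<Sum>a=1..K. D0 * P a + 208 * s2 * ln (real T) / D0)"
    by (rule sum_mono) (rule each)
  also have "\<dots> = D0 * (\<Sum>a=1..K. P a) + 208 * R"
    using B by (simp add: sum.distrib sum_distrib_left)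
  also have "\<dots> \<le> 209 * R"
    using mult_left_mono[OF P, of D0] D0 by simp
  finally show ?thesis
    unfolding expected_regret_eq P_def R_def by simp
qed

end

theorem corollary3:
  "\<exists>C::real. C > 0 \<and>
     (\<forall>(K::nat) (s2::real) (\<nu> :: nat \<Rightarrow> real measure)
       (M :: trajectory measure) (I :: nat \<Rightarrow> trajectory \<Rightarrow> nat) (y :: nat \<Rightarrow> trajectory \<Rightarrow> real) (T::nat).
       K \<ge> 2 \<longrightarrow> s2 > 0 \<longrightarrow> sub_gaussian_bandit K s2 \<nu> \<longrightarrow>
       maillard_sampling M K s2 \<nu> I y \<longrightarrow> T \<ge> 1 \<longrightarrow>
       (\<integral>w. regret K \<nu> (\<lambda>t. I t w) T \<partial>M)
         \<le> C * (sqrt s2 * sqrt (real K * real T * ln (real T))) + (\<Sum>t=1..min K T. gap K \<nu> t))"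
  \<comment> \<open>209 is 208 from the large gaps plus 1 from the small ones.\<close>
  by (intro exI[of _ 209] conjI allI impI maillard_sampling.expected_regret_le) simp_all

end
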